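(* Consider a three-node relay channel with in-block memory of block length $L$ that is reversely physically degraded, i.e., $X_1^L-\mathbf{A}_2^LY_3^L-Y_2^L$ forms a Markov chain (for every $P_{X_1^L\mathbf{A}_2^L}$). Its capacity $C$ is $$C=\frac1L\max_{\mathbf{a}_2^L}\max_{P_{X_1^L}}I(X_1^L;Y_3^L\mid\mathbf{A}_2^L=\mathbf{a}_2^L),$$ where the joint distribution factors as $P(x_1^L,\mathbf{a}_2^L)\,1(x_2^L\,\|\,\mathbf{a}_2^L,0y_2^{L-1})\,P(y_2^L,y_3^L\,\|\,x_1^L,x_2^L)$.
   Context: Model. The source (node 1) has a message $W$, uniformly distributed with entropy $nR$ bits, and sends $X_1^n$, a function of $W$ (no feedback). The relay (node 2) has no message and sends $X_{2,i}$ as a function of its past outputs $Y_2^{i-1}$. The destination (node 3) decodes $W$ from $Y_3^n$. $n=mL$. The channel has memory inside blocks of length $L$ and none across blocks: at position $i$ of a block, $(Y_{2,i},Y_{3,i})$ is a fixed function $f_i$ of $(X_{1}^i,X_{2}^i)$ (the first $i$ inputs of that block) and a noise variable $Z$ that is i.i.d. across blocks and independent of $W$. All alphabets are finite. $C$ is the supremum of rates $R$ (bits per channel use) such that for every $\epsilon>0$ there are an $n$ (a multiple of $L$) and a code with error probability at most $\epsilon$. Notation. A relay block code function $\mathbf{a}_2^L=(\mathbf{a}_{2,1},\dots,\mathbf{a}_{2,L})$ is a tuple of functions $\mathbf{a}_{2,i}:\mathcal{Y}_{2,1}\times\cdots\times\mathcal{Y}_{2,i-1}\to\mathcal{X}_{2,i}$;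 $1(x_2^L\|\mathbf{a}_2^L,0y_2^{L-1})$ is $1$ if $x_{2,i}=\mathbf{a}_{2,i}(y_2^{i-1})$ for all $i$, else $0$. $P(y_2^L,y_3^L\|x_1^L,x_2^L)=\prod_{i=1}^LP(y_{2,i},y_{3,i}\mid y_2^{i-1},y_3^{i-1},x_1^i,x_2^i)$ is the block channel law. *)

theory Defs
  imports "HOL-Probability.Probability"
begin

section \<open>Information-theoretic notions for probability mass functions\<close>

text \<open>
  Restricting \<^term>\<open>measure_pmf p\<close> to its support makes every function on a finitely supported
  \<^term>\<open>p\<close> a simple function, so that this is the library's mutual information of discrete
  random variables (in bits), cf. \<open>pmf_mutual_information_eq\<close> below.
\<close>

definition pmf_mutual_information :: "'w pmf \<Rightarrow> ('w \<Rightarrow> 'a) \<Rightarrow> ('w \<Rightarrow> 'b) \<Rightarrow> real" where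
  "pmf_mutual_information p X Y =
     prob_space.mutual_information (restrict_space (measure_pmf p) (set_pmf p)) 2
       (count_space (X ` set_pmf p)) (count_space (Y ` set_pmf p)) X Y"

text \<open>
  In \<^const>\<open>cond_prob\<close> conditioning on a null event gives \<open>0\<close>, so the equation below only
  constrains those \<open>y\<close> that have positive probability.
\<close>

definition markov_chain :: "'w pmf \<Rightarrow> ('w \<Rightarrow> 'a) \<Rightarrow> ('w \<Rightarrow> 'b) \<Rightarrow> ('w \<Rightarrow> 'c) \<Rightarrow> bool" where
  "markov_chain p X Y Z \<longleftrightarrow>
     (\<forall>x y z. \<P>(w in measure_pmf p. X w = x \<and> Z w = z \<bar> Y w = y) =
        \<P>(w in measure_pmf p. X w = x \<bar> Y w = y) * \<P>(w in measure_pmf p. Z w = z \<bar> Y w = y))"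

definition is_maximum :: "'a::linorder set \<Rightarrow> 'a \<Rightarrow> bool" where
  "is_maximum S m \<longleftrightarrow> m \<in> S \<and> (\<forall>s\<in>S. s \<le> m)"


section \<open>Relay channels with in-block memory\<close>

text \<open>
  Positions inside a block and channel uses are numbered from \<open>0\<close>. Alphabets may depend on the
  position inside the block. The outputs at position \<open>i\<close> are \<open>channel N i x\<^sub>1 x\<^sub>2 z\<close>,
  where \<open>x\<^sub>1\<close>, \<open>x\<^sub>2\<close> are the lists of the first \<open>i + 1\<close> inputs of the block and \<open>z\<close>
  is the noise of the block.
\<close>

record ('x1, 'x2, 'y2, 'y3, 'z) relay_ibm =
  block_length :: nat
  alph_X1 :: "nat \<Rightarrow> 'x1 set"
  alph_X2 :: "nat \<Rightarrow> 'x2 set"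
  alph_Y2 :: "nat \<Rightarrow> 'y2 set"
  alph_Y3 :: "nat \<Rightarrow> 'y3 set"
  noise :: "'z pmf"
  channel :: "nat \<Rightarrow> 'x1 list \<Rightarrow> 'x2 list \<Rightarrow> 'z \<Rightarrow> 'y2 \<times> 'y3"

definition seqs :: "(nat \<Rightarrow> 'a set) \<Rightarrow> nat \<Rightarrow> 'a list set" where
  "seqs A k = {xs. length xs = k \<and> (\<forall>i<k. xs ! i \<in> A i)}"

definition relay_channel :: "('x1, 'x2, 'y2, 'y3, 'z) relay_ibm \<Rightarrow> bool" where
  "relay_channel N \<longleftrightarrow>
     block_length N > 0 \<and>
     (\<forall>i<block_length N.
        finite (alph_X1 N i) \<and> alph_X1 N i \<noteq> {} \<and> finite (alph_X2 N i) \<and> alph_X2 N i \<noteq> {} \<and>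
        finite (alph_Y2 N i) \<and> finite (alph_Y3 N i)) \<and>
     finite (set_pmf (noise N)) \<and>
     (\<forall>i<block_length N. \<forall>x1\<in>seqs (alph_X1 N) (Suc i). \<forall>x2\<in>seqs (alph_X2 N) (Suc i).
        \<forall>z\<in>set_pmf (noise N). channel N i x1 x2 z \<in> alph_Y2 N i \<times> alph_Y3 N i)"

text \<open>
  The first \<open>t\<close> channel uses, as the triple of the sequences of relay inputs, relay outputs and
  destination outputs, for source sequence \<open>x\<^sub>1\<close>, relay functions \<open>r\<close> (the input at time \<open>t\<close> is
  \<open>r t\<close> applied to all relay outputs before time \<open>t\<close>) and noise \<open>zs ! b\<close> in block \<open>b\<close>.
\<close>

primrec transmit :: "('x1, 'x2, 'y2, 'y3, 'z) relay_ibm \<Rightarrow> 'x1 list \<Rightarrow> (nat \<Rightarrow> 'y2 list \<Rightarrow> 'x2) \<Rightarrow>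
    'z list \<Rightarrow> nat \<Rightarrow> 'x2 list \<times> 'y2 list \<times> 'y3 list" where
  "transmit N x1 r zs 0 = ([], [], [])"
| "transmit N x1 r zs (Suc t) =
     (let (x2, y2, y3) = transmit N x1 r zs t;
          x2' = x2 @ [r t y2];
          b = t div block_length N;
          s = b * block_length N;
          (u, v) = channel N (t mod block_length N) (drop s (take (Suc t) x1)) (drop s x2') (zs ! b)
      in (x2', y2 @ [u], y3 @ [v]))"


section \<open>Codes and capacity\<close>

text \<open>
  Codes for \<open>m\<close> blocks, that is, \<open>m * block_length N\<close> channel uses, with messages \<open>{..<M}\<close>.
\<close>

definition valid_code :: "('x1, 'x2, 'y2, 'y3, 'z) relay_ibm \<Rightarrow> nat \<Rightarrow> nat \<Rightarrow>
    (nat \<Rightarrow> 'x1 list) \<Rightarrow> (nat \<Rightarrow> 'y2 list \<Rightarrow> 'x2) \<Rightarrow> bool" where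
  "valid_code N m M enc rel \<longleftrightarrow>
     (let L = block_length N in
       (\<forall>w<M. enc w \<in> seqs (\<lambda>t. alph_X1 N (t mod L)) (m * L)) \<and>
       (\<forall>t<m * L. \<forall>ys\<in>seqs (\<lambda>t. alph_Y2 N (t mod L)) t. rel t ys \<in> alph_X2 N (t mod L)))"

definition error_prob :: "('x1, 'x2, 'y2, 'y3, 'z) relay_ibm \<Rightarrow> nat \<Rightarrow> nat \<Rightarrow>
    (nat \<Rightarrow> 'x1 list) \<Rightarrow> (nat \<Rightarrow> 'y2 list \<Rightarrow> 'x2) \<Rightarrow> ('y3 list \<Rightarrow> nat) \<Rightarrow> real" where
  "error_prob N m M enc rel dec =
     \<P>((w, zs) in measure_pmf (pair_pmf (pmf_of_set {..<M}) (replicate_pmf m (noise N))).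
        case transmit N (enc w) rel zs (m * block_length N) of (x2, y2, y3) \<Rightarrow> dec y3 \<noteq> w)"

text \<open>
  A message that is uniform on \<open>{..<M}\<close> has entropy \<open>n R\<close> bits iff \<open>M = 2\<^bsup>n R\<^esup>\<close>.
\<close>

definition achievable :: "('x1, 'x2, 'y2, 'y3, 'z) relay_ibm \<Rightarrow> real \<Rightarrow> bool" where
  "achievable N R \<longleftrightarrow>
     (\<forall>\<epsilon>>0. \<exists>m>0. \<exists>M enc rel dec.
        real M = 2 powr (real (m * block_length N) * R) \<and>
        valid_code N m M enc rel \<and> error_prob N m M enc rel dec \<le> \<epsilon>)"

definition capacity :: "('x1, 'x2, 'y2, 'y3, 'z) relay_ibm \<Rightarrow> real" where
  "capacity N = Sup {R. achievable N R}"


section \<open>Block code functions and the joint distribution in one block\<close>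

definition relay_codes :: "('x1, 'x2, 'y2, 'y3, 'z) relay_ibm \<Rightarrow> (nat \<Rightarrow> 'y2 list \<Rightarrow> 'x2) set" where
  "relay_codes N = (\<Pi>\<^sub>E i\<in>{..<block_length N}. \<Pi>\<^sub>E ys\<in>seqs (alph_Y2 N) i. alph_X2 N i)"

definition causal_ind :: "nat \<Rightarrow> 'x2 list \<Rightarrow> (nat \<Rightarrow> 'y2 list \<Rightarrow> 'x2) \<Rightarrow> 'y2 list \<Rightarrow> real" where
  "causal_ind L x2 a y2 = of_bool (\<forall>i<L. x2 ! i = a i (take i y2))"

text \<open>
  \<open>P(y\<^sub>2\<^sub>,\<^sub>i, y\<^sub>3\<^sub>,\<^sub>i | y\<^sub>2\<^sup>i\<^sup>-\<^sup>1, y\<^sub>3\<^sup>i\<^sup>-\<^sup>1, x\<^sub>1\<^sup>i, x\<^sub>2\<^sup>i)\<close>. The inputs up to position \<open>i\<close> do not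
  carry information on the noise beyond the past outputs, so it is the conditional probability
  over the noise given the past outputs for fixed inputs; it is \<open>0\<close> for impossible past outputs.
\<close>

definition letter_law :: "('x1, 'x2, 'y2, 'y3, 'z) relay_ibm \<Rightarrow> nat \<Rightarrow>
    'x1 list \<Rightarrow> 'x2 list \<Rightarrow> 'y2 list \<Rightarrow> 'y3 list \<Rightarrow> real" where
  "letter_law N i x1 x2 y2 y3 =
     \<P>(z in measure_pmf (noise N).
        channel N i (take (Suc i) x1) (take (Suc i) x2) z = (y2 ! i, y3 ! i) \<bar>
        \<forall>j<i. channel N j (take (Suc j) x1) (take (Suc j) x2) z = (y2 ! j, y3 ! j))"

definition block_law :: "('x1, 'x2, 'y2, 'y3, 'z) relay_ibm \<Rightarrow>
    'x1 list \<Rightarrow> 'x2 list \<Rightarrow> 'y2 list \<Rightarrow> 'y3 list \<Rightarrow> real" where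
  "block_law N x1 x2 y2 y3 = (\<Prod>i<block_length N. letter_law N i x1 x2 y2 y3)"

definition input_pmfs :: "('x1, 'x2, 'y2, 'y3, 'z) relay_ibm \<Rightarrow> 'x1 list pmf set" where
  "input_pmfs N = {P. set_pmf P \<subseteq> seqs (alph_X1 N) (block_length N)}"

definition input_code_pmfs ::
    "('x1, 'x2, 'y2, 'y3, 'z) relay_ibm \<Rightarrow> ('x1 list \<times> (nat \<Rightarrow> 'y2 list \<Rightarrow> 'x2)) pmf set" where
  "input_code_pmfs N = {P. set_pmf P \<subseteq> seqs (alph_X1 N) (block_length N) \<times> relay_codes N}"

text \<open>
  The distribution of \<open>(X\<^sub>1\<^sup>L, A\<^sub>2\<^sup>L, X\<^sub>2\<^sup>L, Y\<^sub>2\<^sup>L, Y\<^sub>3\<^sup>L)\<close> for given distribution \<open>P\<close> of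
  \<open>(X\<^sub>1\<^sup>L, A\<^sub>2\<^sup>L)\<close>. By \<open>pmf_joint\<close> below the given function is indeed a probability mass
  function, so that \<^const>\<open>embed_pmf\<close> is meaningful.
\<close>

definition joint_mass :: "('x1, 'x2, 'y2, 'y3, 'z) relay_ibm \<Rightarrow>
    ('x1 list \<times> (nat \<Rightarrow> 'y2 list \<Rightarrow> 'x2)) pmf \<Rightarrow>
    'x1 list \<times> (nat \<Rightarrow> 'y2 list \<Rightarrow> 'x2) \<times> 'x2 list \<times> 'y2 list \<times> 'y3 list \<Rightarrow> real" where
  "joint_mass N P = (\<lambda>(x1, a, x2, y2, y3).
     if x2 \<in> seqs (alph_X2 N) (block_length N) \<and> y2 \<in> seqs (alph_Y2 N) (block_length N) \<and>
        y3 \<in> seqs (alph_Y3 N) (block_length N)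
     then pmf P (x1, a) * causal_ind (block_length N) x2 a y2 * block_law N x1 x2 y2 y3 else 0)"

definition joint :: "('x1, 'x2, 'y2, 'y3, 'z) relay_ibm \<Rightarrow>
    ('x1 list \<times> (nat \<Rightarrow> 'y2 list \<Rightarrow> 'x2)) pmf \<Rightarrow>
    ('x1 list \<times> (nat \<Rightarrow> 'y2 list \<Rightarrow> 'x2) \<times> 'x2 list \<times> 'y2 list \<times> 'y3 list) pmf" where
  "joint N P = embed_pmf (joint_mass N P)"

definition rv_X1 where "rv_X1 = (\<lambda>(x1, a, x2, y2, y3). x1)"
definition rv_A2 where "rv_A2 = (\<lambda>(x1, a, x2, y2, y3). a)"
definition rv_Y2 where "rv_Y2 = (\<lambda>(x1, a, x2, y2, y3). y2)"
definition rv_Y3 where "rv_Y3 = (\<lambda>(x1, a, x2, y2, y3). y3)"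

definition reversely_degraded :: "('x1, 'x2, 'y2, 'y3, 'z) relay_ibm \<Rightarrow> bool" where
  "reversely_degraded N \<longleftrightarrow>
     (\<forall>P\<in>input_code_pmfs N. markov_chain (joint N P) rv_X1 (\<lambda>w. (rv_A2 w, rv_Y3 w)) rv_Y2)"

text \<open>
  \<open>I(X\<^sub>1\<^sup>L; Y\<^sub>3\<^sup>L | A\<^sub>2\<^sup>L = a)\<close>, the mutual information under the conditional distribution given
  the event \<open>A\<^sub>2\<^sup>L = a\<close> (which must have positive probability under \<open>P\<close>).
\<close>

definition info_X1_Y3_given :: "('x1, 'x2, 'y2, 'y3, 'z) relay_ibm \<Rightarrow>
    ('x1 list \<times> (nat \<Rightarrow> 'y2 list \<Rightarrow> 'x2)) pmf \<Rightarrow> (nat \<Rightarrow> 'y2 list \<Rightarrow> 'x2) \<Rightarrow> real" where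
  "info_X1_Y3_given N P a =
     pmf_mutual_information (cond_pmf (joint N P) {w. rv_A2 w = a}) rv_X1 rv_Y3"


section \<open>Well-definedness\<close>

lemma pmf_mutual_information_eq:
  assumes fin: "finite (set_pmf p)"
  shows "pmf_mutual_information p X Y =
    (\<Sum>(x, y)\<in>(\<lambda>w. (X w, Y w)) ` set_pmf p.
      pmf (map_pmf (\<lambda>w. (X w, Y w)) p) (x, y) *
      log 2 (pmf (map_pmf (\<lambda>w. (X w, Y w)) p) (x, y) /
        (pmf (map_pmf X p) x * pmf (map_pmf Y p) y)))"
proof -
  let ?M = "restrict_space (measure_pmf p) (set_pmf p)"
  have sp: "space ?M = set_pmf p" by (simp add: space_restrict_space)
  have se: "sets ?M = Pow (set_pmf p)" by (auto simp: sets_restrict_space)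
  interpret prob_space ?M
  proof
    show "emeasure ?M (space ?M) = 1"
      by (simp add: sp emeasure_restrict_space emeasure_pmf)
  qed
  interpret information_space ?M 2
    by unfold_locales simp
  have mea: "measure ?M A = measure (measure_pmf p) A" if "A \<subseteq> set_pmf p" for A
    using that by (simp add: measure_restrict_space)
  have sd: "simple_distributed ?M f (\<lambda>x. pmf (map_pmf f p) x)" for f :: "'a \<Rightarrow> 'd"
  proof (rule simple_distributedI)
    show "simple_function ?M f"
      unfolding simple_function_def using fin by (auto simp: sp se)
    fix x
    have "measure ?M (f -` {x} \<inter> space ?M) = measure (measure_pmf p) (f -` {x} \<inter> set_pmf p)"
      by (simp add: sp mea)
    also have "\<dots> = pmf (map_pmf f p) x"
      by (simp add: measure_Int_set_pmf pmf_map)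
    finally show "pmf (map_pmf f p) x = measure ?M (f -` {x} \<inter> space ?M)" by simp
  qed auto
  show ?thesis
    unfolding pmf_mutual_information_def
    using mutual_information_simple_distributed[OF sd[of X] sd[of Y] sd[of "\<lambda>w. (X w, Y w)"]]
    by (simp add: sp)
qed

text \<open>
  The joint distribution is that of one block of \<^const>\<open>transmit\<close>, with source sequence and
  block code function drawn from \<open>P\<close> independently of the noise.
\<close>

lemma transmit_block_eq_iff:
  assumes "length x2 = k" "length y2 = k" "length y3 = k" "k \<le> block_length N"
  shows "transmit N x1 a [z] k = (x2, y2, y3) \<longleftrightarrow>
    (\<forall>i<k. x2 ! i = a i (take i y2) \<and>
      channel N i (take (Suc i) x1) (take (Suc i) x2) z = (y2 ! i, y3 ! i))"
  using assms
proof (induction k arbitrary: x2 y2 y3)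
  case 0
  then show ?case by simp
next
  case (Suc k)
  obtain x2' c where x2: "x2 = x2' @ [c]" "length x2' = k"
    using Suc.prems(1) by (cases x2 rule: rev_cases) auto
  obtain y2' u where y2: "y2 = y2' @ [u]" "length y2' = k"
    using Suc.prems(2) by (cases y2 rule: rev_cases) auto
  obtain y3' v where y3: "y3 = y3' @ [v]" "length y3' = k"
    using Suc.prems(3) by (cases y3 rule: rev_cases) auto
  have k: "k div block_length N = 0" "k mod block_length N = k"
    using Suc.prems(4) by auto
  obtain p q r where t: "transmit N x1 a [z] k = (p, q, r)"
    by (cases "transmit N x1 a [z] k") auto
  have IH: "(p, q, r) = (x2', y2', y3') \<longleftrightarrow>
    (\<forall>i<k. x2' ! i = a i (take i y2') \<and>
      channel N i (take (Suc i) x1) (take (Suc i) x2') z = (y2' ! i, y3' ! i))"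
    using Suc.IH[OF x2(2) y2(2) y3(2)] Suc.prems(4) t by simp
  have "transmit N x1 a [z] (Suc k) = (x2, y2, y3) \<longleftrightarrow>
    (p, q, r) = (x2', y2', y3') \<and> c = a k y2' \<and> channel N k (take (Suc k) x1) x2 z = (u, v)"
    by (auto simp: t k x2 y2 y3 Let_def split: prod.splits)
  also have "\<dots> \<longleftrightarrow> (\<forall>i<Suc k. x2 ! i = a i (take i y2) \<and>
      channel N i (take (Suc i) x1) (take (Suc i) x2) z = (y2 ! i, y3 ! i))"
    unfolding IH using x2 y2 y3 by (auto simp: less_Suc_eq nth_append)
  finally show ?case .
qed

lemma transmit_block_in_seqs:
  assumes N: "relay_channel N" and x1: "x1 \<in> seqs (alph_X1 N) (block_length N)"
    and a: "a \<in> relay_codes N" and z: "z \<in> set_pmf (noise N)" and k: "k \<le> block_length N"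
    and t: "transmit N x1 a [z] k = (x2, y2, y3)"
  shows "x2 \<in> seqs (alph_X2 N) k \<and> y2 \<in> seqs (alph_Y2 N) k \<and> y3 \<in> seqs (alph_Y3 N) k"
  using k t
proof (induction k arbitrary: x2 y2 y3)
  case 0
  then show ?case by (auto simp: seqs_def)
next
  case (Suc k)
  obtain p q r where t: "transmit N x1 a [z] k = (p, q, r)"
    by (cases "transmit N x1 a [z] k") auto
  have m: "k div block_length N = 0" "k mod block_length N = k"
    using Suc.prems(1) by auto
  have IH: "p \<in> seqs (alph_X2 N) k" "q \<in> seqs (alph_Y2 N) k" "r \<in> seqs (alph_Y3 N) k"
    using Suc.IH[OF _ t] Suc.prems(1) by auto
  have snoc: "xs @ [x] \<in> seqs A (Suc k)" if "xs \<in> seqs A k" "x \<in> A k" for xs x and A :: "nat \<Rightarrow> 'w set"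
    using that by (auto simp: seqs_def nth_append less_Suc_eq)
  have "a k q \<in> alph_X2 N k"
    using a IH(2) Suc.prems(1) by (auto simp: relay_codes_def PiE_iff)
  hence p': "p @ [a k q] \<in> seqs (alph_X2 N) (Suc k)"
    using IH(1) by (auto simp: seqs_def nth_append less_Suc_eq)
  have x1': "take (Suc k) x1 \<in> seqs (alph_X1 N) (Suc k)"
    using x1 Suc.prems(1) by (auto simp: seqs_def)
  have "channel N k (take (Suc k) x1) (p @ [a k q]) z \<in> alph_Y2 N k \<times> alph_Y3 N k"
    using N x1' p' z Suc.prems(1) by (auto simp: relay_channel_def)
  then show ?case
    using Suc.prems(2) p' IH(2,3)
    by (auto simp: t m Let_def seqs_def nth_append less_Suc_eq split: prod.splits)
qed

lemma block_law_eq: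
  "block_law N x1 x2 y2 y3 = measure (measure_pmf (noise N))
    {z. \<forall>i<block_length N. channel N i (take (Suc i) x1) (take (Suc i) x2) z = (y2 ! i, y3 ! i)}"
proof -
  define A where "A k = {z. \<forall>i<k. channel N i (take (Suc i) x1) (take (Suc i) x2) z = (y2 ! i, y3 ! i)}" for k
  have "(\<Prod>i<k. letter_law N i x1 x2 y2 y3) = measure (measure_pmf (noise N)) (A k)" for k
  proof (induction k)
    case 0
    then show ?case by (simp add: A_def)
  next
    case (Suc k)
    have "letter_law N k x1 x2 y2 y3 =
        measure (measure_pmf (noise N)) (A (Suc k)) / measure (measure_pmf (noise N)) (A k)"
      unfolding letter_law_def cond_prob_def A_def
      by (auto intro!: arg_cong2[where f = "(/)"] arg_cong[where f = "measure (measure_pmf (noise N))"]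
          simp: less_Suc_eq)
    moreover have "measure (measure_pmf (noise N)) (A (Suc k)) \<le> measure (measure_pmf (noise N)) (A k)"
      by (intro measure_pmf.finite_measure_mono) (auto simp: A_def)
    ultimately show ?case
      using Suc measure_nonneg[of "measure_pmf (noise N)" "A (Suc k)"]
      by (cases "measure (measure_pmf (noise N)) (A k) = 0") simp_all
  qed
  from this[of "block_length N"] show ?thesis by (simp add: block_law_def A_def)
qed

lemma
  assumes N: "relay_channel N" and P: "P \<in> input_code_pmfs N"
  shows pmf_joint: "pmf (joint N P) w = joint_mass N P w"
    and joint_eq_transmit: "joint N P =
      map_pmf (\<lambda>((x1, a), z). (x1, a, transmit N x1 a [z] (block_length N))) (pair_pmf P (noise N))"
      (is "_ = ?Q")
proof -
  let ?L = "block_length N"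
  have pmf_Q: "pmf ?Q w = joint_mass N P w" for w
  proof -
    obtain x1 a x2 y2 y3 where w: "w = (x1, a, x2, y2, y3)" by (cases w) auto
    have "?Q = bind_pmf P (\<lambda>v. map_pmf (\<lambda>z. (fst v, snd v, transmit N (fst v) (snd v) [z] ?L)) (noise N))"
      by (simp add: pair_pmf_def map_bind_pmf map_pmf_def bind_assoc_pmf bind_return_pmf case_prod_beta)
    hence "pmf ?Q w = (\<integral>v. pmf (map_pmf (\<lambda>z. (fst v, snd v, transmit N (fst v) (snd v) [z] ?L)) (noise N)) w \<partial>measure_pmf P)"
      by (simp add: pmf_bind case_prod_beta)
    also have "\<dots> = (\<integral>v. indicator {(x1, a)} v *
        measure (measure_pmf (noise N)) {z. transmit N x1 a [z] ?L = (x2, y2, y3)} \<partial>measure_pmf P)"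
    proof (intro Bochner_Integration.integral_cong refl)
      fix v
      show "pmf (map_pmf (\<lambda>z. (fst v, snd v, transmit N (fst v) (snd v) [z] ?L)) (noise N)) w =
        indicator {(x1, a)} v * measure (measure_pmf (noise N)) {z. transmit N x1 a [z] ?L = (x2, y2, y3)}"
        by (cases "v = (x1, a)") (auto simp: w pmf_map vimage_def prod_eq_iff)
    qed
    also have "\<dots> = pmf P (x1, a) * measure (measure_pmf (noise N)) {z. transmit N x1 a [z] ?L = (x2, y2, y3)}"
      by (simp add: pmf.rep_eq)
    also have "\<dots> = joint_mass N P w"
    proof (cases "(x1, a) \<in> set_pmf P")
      case False
      then show ?thesis by (simp add: w joint_mass_def set_pmf_iff)
    next
      case True
      hence xa: "x1 \<in> seqs (alph_X1 N) ?L" "a \<in> relay_codes N"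
        using P by (auto simp: input_code_pmfs_def)
      show ?thesis
      proof (cases "x2 \<in> seqs (alph_X2 N) ?L \<and> y2 \<in> seqs (alph_Y2 N) ?L \<and> y3 \<in> seqs (alph_Y3 N) ?L")
        case True
        hence l: "length x2 = ?L" "length y2 = ?L" "length y3 = ?L" by (auto simp: seqs_def)
        show ?thesis
        proof (cases "\<forall>i<?L. x2 ! i = a i (take i y2)")
          case c: True
          show ?thesis
            using True c unfolding w joint_mass_def block_law_eq transmit_block_eq_iff[OF l order_refl]
            by (simp add: causal_ind_def)
        next
          case c: False
          hence "{z. transmit N x1 a [z] ?L = (x2, y2, y3)} = {}"
            unfolding transmit_block_eq_iff[OF l order_refl] by blast
          thus ?thesis using c by (simp add: w joint_mass_def causal_ind_def)
        qed
      next
        case False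
        have "{z. transmit N x1 a [z] ?L = (x2, y2, y3)} \<inter> set_pmf (noise N) = {}"
          using transmit_block_in_seqs[OF N xa _ order_refl] False by blast
        hence "measure (measure_pmf (noise N)) {z. transmit N x1 a [z] ?L = (x2, y2, y3)} = 0"
          by (simp add: measure_pmf_zero_iff Int_commute)
        then show ?thesis using False by (auto simp: w joint_mass_def)
      qed
    qed
    finally show ?thesis .
  qed
  hence "joint_mass N P = pmf ?Q" by auto
  hence "joint N P = ?Q" by (simp add: joint_def td_pmf_embed_pmf[THEN type_definition.Rep_inverse])
  thus "joint N P = ?Q" .
  thus "pmf (joint N P) w = joint_mass N P w" using pmf_Q by simp
qed

end

theory Submission
  imports Defs
begin

text \<open>
  Achievability: with a fixed block code function \<open>a\<close> repeated in every block, the channel from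
  \<open>X\<^sub>1\<^sup>L\<close> to \<open>Y\<^sub>3\<^sup>L\<close> is memoryless, and Feinstein's greedy choice of codewords reaches its capacity.

  Converse: give the destination \<open>Y\<^sub>2\<close> as well. Then the block code function that the relay uses in
  a block is known to the destination, and reverse degradedness turns
  \<open>I(X\<^sub>1\<^sup>L; Y\<^sub>2\<^sup>L Y\<^sub>3\<^sup>L | a)\<close> into \<open>I(X\<^sub>1\<^sup>L; Y\<^sub>3\<^sup>L | a)\<close>. Peeling off the first block replaces the
  prior on the messages by the posterior given its outputs, and lowers the expected entropy of the
  message by at most that mutual information.
\<close>

section \<open>Entropy functionals and mutual information of finite distributions\<close>

text \<open>Relay inputs may depend on relay outputs of all earlier blocks, which the destination
  never sees; from \<open>Y3\<close> alone the blocks therefore do not decouple, and this is what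
  the gift of \<open>Y2\<close> repairs. Its price is that degradedness must hold for whatever input
  law the posterior of the message induces in a block, so one fixed input distribution would not do.
  The converse works with unnormalized weights, so that the induction over blocks treats outputs of
  probability 0 like all others, and the decoder enters only through a guess \<open>q y w\<close>
  whose expected logarithm is compared with the entropy of the message. On the coding side the
  obstacle is arithmetic: \<open>achievable\<close> asks for exactly 2 powr (n R) messages, which
  must be an integer. Hence only rates j / (k L) with naturals j and k are constructed; they are
  dense, and only a supremum is wanted.\<close>

lemma expectation_bind_pmf_finite:
  fixes h :: "'b \<Rightarrow> real"
  assumes "finite (set_pmf p)" "\<And>x. x \<in> set_pmf p \<Longrightarrow> finite (set_pmf (f x))"
  shows "measure_pmf.expectation (bind_pmf p f) h =
    measure_pmf.expectation p (\<lambda>x. measure_pmf.expectation (f x) h)"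
  using assms
  by (subst pmf_expectation_bind[of "set_pmf p"]) (auto simp: integral_measure_pmf[of "set_pmf p"])

lemma measure_bind_pmf:
  "measure_pmf.prob (bind_pmf p f) S = measure_pmf.expectation p (\<lambda>x. measure_pmf.prob (f x) S)"
proof -
  have "ennreal (measure_pmf.prob (bind_pmf p f) S) = emeasure (bind_pmf p f) S"
    by (rule measure_pmf.emeasure_eq_measure[symmetric])
  also have "\<dots> = (\<integral>\<^sup>+x. emeasure (f x) S \<partial>measure_pmf p)"
    by (rule emeasure_bind_pmf)
  also have "\<dots> = (\<integral>\<^sup>+x. ennreal (measure_pmf.prob (f x) S) \<partial>measure_pmf p)"
    by (simp only: measure_pmf.emeasure_eq_measure)
  also have "\<dots> = ennreal (measure_pmf.expectation p (\<lambda>x. measure_pmf.prob (f x) S))"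
    by (intro nn_integral_eq_integral measure_pmf.integrable_const_bound[where B = 1]) auto
  finally show ?thesis
    by (subst (asm) ennreal_inj) (auto intro!: integral_nonneg_AE)
qed

lemma expectation_mono_on:
  fixes f g :: "'a \<Rightarrow> real"
  assumes "finite (set_pmf p)" "\<And>x. x \<in> set_pmf p \<Longrightarrow> f x \<le> g x"
  shows "measure_pmf.expectation p f \<le> measure_pmf.expectation p g"
  using assms by (intro integral_mono_AE integrable_measure_pmf_finite) (auto simp: AE_measure_pmf_iff)

lemma expectation_cong_on:
  fixes f g :: "'a \<Rightarrow> real"
  assumes "\<And>x. x \<in> set_pmf p \<Longrightarrow> f x = g x"
  shows "measure_pmf.expectation p f = measure_pmf.expectation p g"
  using assms by (intro integral_cong_AE) (auto simp: AE_measure_pmf_iff)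

section \<open>Terms t log t, and mutual information as a functional of input law and
  channel\<close>

definition xlog :: "real \<Rightarrow> real" where
  "xlog t = t * log 2 t"

lemma xlog_mult: "xlog (a * b) = a * xlog b + b * xlog a" if "a \<ge> 0" "b \<ge> 0"
  using that by (cases "a = 0 \<or> b = 0") (auto simp: xlog_def log_mult algebra_simps)

text \<open>Only the point 0 needs an argument: at t = 1/x the value is -(ln x / x) / ln 2, which
  tends to 0 as x grows. Continuity up to 0 matters because a maximizing input law may lie on the
  boundary of the simplex.\<close>

lemma continuous_on_xlog: "continuous_on {0..} xlog"
proof -
  have "((\<lambda>x::real. - (ln x / x) / ln 2) \<longlongrightarrow> - 0 / ln 2) at_top"
    by (intro tendsto_intros ln_x_over_x_tendsto_0) auto
  moreover have "eventually (\<lambda>x::real. - (ln x / x) / ln 2 = xlog (inverse x)) at_top"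
    using eventually_gt_at_top[of 0]
    by eventually_elim (simp add: xlog_def log_def ln_inverse divide_inverse)
  ultimately have *: "(xlog \<longlongrightarrow> xlog 0) (at_right 0)"
    unfolding filterlim_at_right_to_top by (simp add: xlog_def tendsto_cong)
  show ?thesis
    unfolding continuous_on_def
  proof
    fix x :: real assume "x \<in> {0..}"
    show "(xlog \<longlongrightarrow> xlog x) (at x within {0..})"
    proof (cases "x = 0")
      case True
      thus ?thesis using * by (simp add: at_within_Ici_at_right)
    next
      case False
      hence "isCont xlog x" using \<open>x \<in> {0..}\<close> unfolding xlog_def[abs_def] log_def
        by (intro continuous_intros) auto
      thus ?thesis
        using continuous_at_imp_continuous_at_within continuous_within by blast
    qed
  qed
qed

text \<open>\<open>H(Y) - H(Y | X)\<close> for input distribution \<open>p\<close> and channel \<open>K\<close>.\<close>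

definition channel_information :: "'a set \<Rightarrow> 'b set \<Rightarrow> ('a \<Rightarrow> real) \<Rightarrow> ('a \<Rightarrow> 'b \<Rightarrow> real) \<Rightarrow> real" where
  "channel_information A B p K = (\<Sum>x\<in>A. p x * (\<Sum>y\<in>B. xlog (K x y))) - (\<Sum>y\<in>B. xlog (\<Sum>x\<in>A. p x * K x y))"

text \<open>The difference of entropies is visibly continuous in \<open>p\<close>; the average
  log-likelihood ratio is what degradedness and channel coding act on. Terms with
  \<open>p x * K x y = 0\<close> vanish in both forms, and for the others the output probability is
  at least \<open>p x * K x y\<close>, so the logarithm of the quotient splits.\<close>

lemma channel_information_log_form:
  assumes "finite A" "finite B" "\<And>x. x \<in> A \<Longrightarrow> p x \<ge> 0" "\<And>x y. x \<in> A \<Longrightarrow> y \<in> B \<Longrightarrow> K x y \<ge> 0"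
  shows "channel_information A B p K =
    (\<Sum>x\<in>A. \<Sum>y\<in>B. p x * K x y * log 2 (K x y / (\<Sum>x'\<in>A. p x' * K x' y)))"
proof -
  define Q where "Q y = (\<Sum>x\<in>A. p x * K x y)" for y
  have *: "p x * K x y * log 2 (K x y / Q y) = p x * xlog (K x y) - p x * K x y * log 2 (Q y)"
    if "x \<in> A" "y \<in> B" for x y
  proof (cases "p x * K x y = 0")
    case True
    thus ?thesis by (auto simp: xlog_def)
  next
    case False
    hence "0 < p x * K x y" using assms(3,4)[OF \<open>x \<in> A\<close>] that by (simp add: less_le)
    also have "\<dots> \<le> Q y" unfolding Q_def
      using assms that by (intro member_le_sum) auto
    finally have "Q y > 0" .
    moreover have "K x y > 0" using False assms(4)[OF that] by auto
    ultimately show ?thesis by (simp add: log_divide xlog_def algebra_simps)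
  qed
  have "(\<Sum>x\<in>A. \<Sum>y\<in>B. p x * K x y * log 2 (K x y / Q y)) =
    (\<Sum>x\<in>A. \<Sum>y\<in>B. p x * xlog (K x y) - p x * K x y * log 2 (Q y))"
    by (intro sum.cong refl *)
  also have "\<dots> = (\<Sum>x\<in>A. p x * (\<Sum>y\<in>B. xlog (K x y))) - (\<Sum>x\<in>A. \<Sum>y\<in>B. p x * K x y * log 2 (Q y))"
    by (simp add: sum_subtractf sum_distrib_left)
  also have "(\<Sum>x\<in>A. \<Sum>y\<in>B. p x * K x y * log 2 (Q y)) = (\<Sum>y\<in>B. Q y * log 2 (Q y))"
    by (subst sum.swap) (simp add: Q_def sum_distrib_right)
  finally show ?thesis
    by (simp add: channel_information_def Q_def xlog_def)
qed

text \<open>Bridge from the measure-theoretic notion in the statement to a finite sum.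
  \<open>A\<close> and \<open>B\<close> may exceed the supports, so that one pair of alphabets
  serves all input laws, as the maximization over the simplex requires.\<close>

lemma pmf_mutual_information_eq_channel_information:
  assumes "finite A" "finite B" "set_pmf p \<subseteq> A" "\<And>x. x \<in> set_pmf p \<Longrightarrow> set_pmf (K x) \<subseteq> B"
    and J: "finite (set_pmf J)" "map_pmf (\<lambda>w. (X w, Y w)) J = bind_pmf p (\<lambda>x. map_pmf (Pair x) (K x))"
  shows "pmf_mutual_information J X Y = channel_information A B (pmf p) (\<lambda>x. pmf (K x))"
proof -
  define Q where "Q y = (\<Sum>x\<in>A. pmf p x * pmf (K x) y)" for y
  have XY: "pmf (map_pmf (\<lambda>w. (X w, Y w)) J) (x, y) = pmf p x * pmf (K x) y" for x y
  proof -
    have "pmf (map_pmf (\<lambda>w. (X w, Y w)) J) (x, y) =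
        (\<integral>v. pmf (map_pmf (Pair v) (K v)) (x, y) \<partial>measure_pmf p)"
      by (simp add: J(2) pmf_bind)
    also have "\<dots> = (\<integral>v. indicator {x} v * pmf (K x) y \<partial>measure_pmf p)"
    proof (intro Bochner_Integration.integral_cong refl)
      fix v show "pmf (map_pmf (Pair v) (K v)) (x, y) = indicator {x} v * pmf (K x) y"
      proof (cases "v = x")
        case True
        have "inj (Pair x)" by (auto simp: inj_on_def)
        thus ?thesis using True pmf_map_inj'[of "Pair x" "K x" y] by simp
      next
        case False
        hence "(x, y) \<notin> set_pmf (map_pmf (Pair v) (K v))" by auto
        hence "pmf (map_pmf (Pair v) (K v)) (x, y) = 0"
          by (rule pmf_eq_0_set_pmf[THEN iffD2])
        thus ?thesis using False by simp
      qed
    qed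
    also have "\<dots> = pmf p x * pmf (K x) y" by (simp add: pmf.rep_eq)
    finally show ?thesis .
  qed
  have "map_pmf X J = map_pmf fst (map_pmf (\<lambda>w. (X w, Y w)) J)"
    by (simp add: pmf.map_comp o_def)
  also have "\<dots> = p" unfolding J(2)
    by (simp add: map_bind_pmf pmf.map_comp o_def map_pmf_const bind_return_pmf')
  finally have X: "map_pmf X J = p" .
  have "map_pmf Y J = map_pmf snd (map_pmf (\<lambda>w. (X w, Y w)) J)"
    by (simp add: pmf.map_comp o_def)
  also have "\<dots> = bind_pmf p K" unfolding J(2)
    by (simp add: map_bind_pmf pmf.map_comp o_def)
  finally have Y: "pmf (map_pmf Y J) y = Q y" for y
    using assms(1,3) by (auto simp: pmf_bind Q_def set_pmf_iff intro!: integral_measure_pmf[THEN trans])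
  have im: "(\<lambda>w. (X w, Y w)) ` set_pmf J = set_pmf (map_pmf (\<lambda>w. (X w, Y w)) J)" by simp
  have "pmf_mutual_information J X Y = (\<Sum>(x, y)\<in>(\<lambda>w. (X w, Y w)) ` set_pmf J.
     pmf p x * pmf (K x) y * log 2 (pmf p x * pmf (K x) y / (pmf p x * Q y)))"
    by (simp add: pmf_mutual_information_eq[OF J(1)] XY X Y)
  also have "\<dots> = (\<Sum>(x, y)\<in>A \<times> B.
     pmf p x * pmf (K x) y * log 2 (pmf p x * pmf (K x) y / (pmf p x * Q y)))"
  proof (intro sum.mono_neutral_left ballI)
    show "(\<lambda>w. (X w, Y w)) ` set_pmf J \<subseteq> A \<times> B"
      unfolding im J(2) using assms(3,4) by auto
    fix i assume "i \<in> A \<times> B - (\<lambda>w. (X w, Y w)) ` set_pmf J"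
    hence "pmf (map_pmf (\<lambda>w. (X w, Y w)) J) i = 0"
      unfolding im by (intro pmf_eq_0_set_pmf[THEN iffD2]) blast
    thus "(case i of (x, y) \<Rightarrow> pmf p x * pmf (K x) y *
      log 2 (pmf p x * pmf (K x) y / (pmf p x * Q y))) = 0"
      by (cases i) (auto simp: XY)
  qed (use assms in auto)
  also have "\<dots> = (\<Sum>(x, y)\<in>A \<times> B. pmf p x * pmf (K x) y * log 2 (pmf (K x) y / Q y))"
    by (intro sum.cong) auto
  also have "\<dots> = channel_information A B (pmf p) (\<lambda>x. pmf (K x))"
    using assms(1,2) by (subst channel_information_log_form) (auto simp: Q_def sum.cartesian_product)
  finally show ?thesis .
qed

section \<open>Existence of a maximizing input distribution\<close>

lemma compact_simplex_fun:
  assumes "finite A"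
  shows "compact {f :: 'a \<Rightarrow> real. (\<forall>x\<in>A. f x \<ge> 0) \<and> (\<forall>x. x \<notin> A \<longrightarrow> f x = 0) \<and> sum f A = 1}" (is "compact ?S")
proof -
  \<comment> \<open>Tychonoff applies to the product of these factors. Coordinates outside
    \<open>A\<close> are pinned to 0, so that points of the simplex correspond to distributions
    supported in \<open>A\<close>.\<close>
  let ?I = "\<lambda>x. if x \<in> A then {0..1} else {0::real}"
  have "compactin (product_topology (\<lambda>x. euclidean) UNIV) (PiE UNIV ?I)"
    by (simp add: compactin_PiE)
  hence *: "compact (PiE UNIV ?I)"
    by (simp add: euclidean_product_topology)
  have S: "?S = PiE UNIV ?I \<inter> {f. sum f A = 1}"
  proof (intro set_eqI iffI)
    fix f assume f: "f \<in> ?S"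
    have "f x \<le> 1" if "x \<in> A" for x
      using member_le_sum[of x A f] f that assms by auto
    thus "f \<in> PiE UNIV ?I \<inter> {f. sum f A = 1}" using f by auto
  next
    fix f assume f: "f \<in> PiE UNIV ?I \<inter> {f. sum f A = 1}"
    have I: "f x \<in> ?I x" for x using f by (auto simp: PiE_def Pi_def)
    have "f x \<ge> 0" if "x \<in> A" for x using I[of x] that by simp
    moreover have "f x = 0" if "x \<notin> A" for x using I[of x] that by simp
    ultimately show "f \<in> ?S" using f by simp
  qed
  have "closed {f :: 'a \<Rightarrow> real. sum f A = 1}"
    by (intro closed_Collect_eq continuous_intros) auto
  thus ?thesis unfolding S using * compact_Int_closed by blast
qed

lemma pmf_of_simplex:
  assumes "finite A" "\<And>x. x \<in> A \<Longrightarrow> f x \<ge> 0" "\<And>x. x \<notin> A \<Longrightarrow> f x = 0" "sum f A = (1::real)"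
  obtains p where "pmf p = f" "set_pmf p \<subseteq> A"
proof -
  have nn: "f x \<ge> 0" for x using assms(2,3) by (cases "x \<in> A") auto
  have "(\<integral>\<^sup>+x. ennreal (f x) \<partial>count_space UNIV) = (\<Sum>x\<in>A. ennreal (f x))"
    using assms by (intro nn_integral_count_space'[THEN trans]) auto
  also have "\<dots> = 1" using assms nn by (simp add: sum_ennreal)
  finally have "pmf (embed_pmf f) x = f x" for x
    using nn by (intro pmf_embed_pmf) auto
  moreover from this have "set_pmf (embed_pmf f) \<subseteq> A"
    using assms(3) by (metis set_pmf_iff subsetI)
  ultimately show ?thesis by (intro that) auto
qed

lemma channel_information_attains_max:
  assumes "finite A" "finite B" "A \<noteq> {}" "\<And>x y. x \<in> A \<Longrightarrow> y \<in> B \<Longrightarrow> K x y \<ge> 0"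
  obtains p where "set_pmf p \<subseteq> A" "\<And>q. set_pmf q \<subseteq> A \<Longrightarrow> channel_information A B (pmf q) K \<le> channel_information A B (pmf p) K"
proof -
  let ?S = "{f :: 'a \<Rightarrow> real. (\<forall>x\<in>A. f x \<ge> 0) \<and> (\<forall>x. x \<notin> A \<longrightarrow> f x = 0) \<and> sum f A = 1}"
  have c: "continuous_on ?S (\<lambda>f. f x)" for x
    by (rule continuous_on_subset[OF continuous_on_product_coordinates]) auto
  have "continuous_on ?S (\<lambda>f. channel_information A B f K)"
    unfolding channel_information_def using assms
    by (intro continuous_intros c continuous_on_compose2[OF continuous_on_xlog])
       (auto intro!: sum_nonneg)
  moreover
  have pS: "pmf q \<in> ?S" if "set_pmf q \<subseteq> A" for q
    using that assms(1) sum_pmf_eq_1[of A q] by (auto simp: set_pmf_iff)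
  moreover obtain x where "x \<in> A" using assms(3) by auto
  hence "?S \<noteq> {}" using pS[of "return_pmf x"] by auto
  ultimately have "\<exists>f\<in>?S. \<forall>g\<in>?S. channel_information A B g K \<le> channel_information A B f K"
    by (intro continuous_attains_sup compact_simplex_fun assms(1))
  then obtain f where f: "f \<in> ?S" "\<forall>g\<in>?S. channel_information A B g K \<le> channel_information A B f K"
    by (rule bexE)
  obtain p where "pmf p = f" "set_pmf p \<subseteq> A"
    using f(1) by (auto intro: pmf_of_simplex[OF assms(1), of f])
  show ?thesis
  proof (rule that)
    fix q :: "'a pmf" assume "set_pmf q \<subseteq> A"
    thus "channel_information A B (pmf q) K \<le> channel_information A B (pmf p) K"
      unfolding \<open>pmf p = f\<close> by (intro bspec[OF f(2)] pS)
  qed fact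
qed

section \<open>Blocks of the channel\<close>

lemma transmit_length:
  assumes "transmit N x1 r zs t = (x2, y2, y3)"
  shows "length x2 = t \<and> length y2 = t \<and> length y3 = t"
  using assms by (induction t arbitrary: x2 y2 y3) (auto simp: Let_def split: prod.splits)

lemma transmit_first_block:
  assumes "k \<le> block_length N"
  shows "transmit N x1 r (z # zs) k = transmit N (take (block_length N) x1) r [z] k"
  using assms
proof (induction k)
  case (Suc k)
  hence "k div block_length N = 0" "min (Suc k) (block_length N) = Suc k" by auto
  with Suc show ?case by (auto simp: Let_def min.commute split: prod.splits)
qed auto

text \<open>What the relay saw in the first block can be absorbed into its functions: with
  \<open>y2\<close> fixed, the remaining transmission is again a transmission from time 0, for relay
  functions shifted by one block. This is what permits induction over blocks.\<close>

lemma transmit_append: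
  assumes L: "block_length N > 0"
    and first: "transmit N (take (block_length N) x1) r [z] (block_length N) = (x2, y2, y3)"
    and rest: "transmit N (drop (block_length N) x1) (\<lambda>i ys. r (block_length N + i) (y2 @ ys)) zs t = (u2, v2, v3)"
  shows "transmit N x1 r (z # zs) (block_length N + t) = (x2 @ u2, y2 @ v2, y3 @ v3)"
  using rest
proof (induction t arbitrary: u2 v2 v3)
  case 0
  then show ?case using transmit_first_block[of "block_length N" N x1 r z zs] first by simp
next
  case (Suc t)
  let ?L = "block_length N"
  obtain p q s where t: "transmit N (drop ?L x1) (\<lambda>i ys. r (?L + i) (y2 @ ys)) zs t = (p, q, s)"
    by (cases "transmit N (drop ?L x1) (\<lambda>i ys. r (?L + i) (y2 @ ys)) zs t") auto
  have "length x2 = ?L" using transmit_length[OF first] by simp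
  moreover have "(?L + t) div ?L = Suc (t div ?L)" using L by simp
  moreover have "drop (?L + t div ?L * ?L) (take (Suc (?L + t)) x1) =
    drop (t div ?L * ?L) (take (Suc t) (drop ?L x1))"
    by (simp add: take_drop drop_drop add.commute)
  ultimately show ?case
    using Suc.prems Suc.IH[OF t] by (auto simp: t Let_def split: prod.splits)
qed

section \<open>One block as a channel from the source block to the outputs\<close>

definition block_out :: "('x1, 'x2, 'y2, 'y3, 'z) relay_ibm \<Rightarrow> (nat \<Rightarrow> 'y2 list \<Rightarrow> 'x2) \<Rightarrow>
    'x1 list \<Rightarrow> 'z \<Rightarrow> 'y2 list \<times> 'y3 list" where
  "block_out N a x z = snd (transmit N x a [z] (block_length N))"

definition block_kernel :: "('x1, 'x2, 'y2, 'y3, 'z) relay_ibm \<Rightarrow> (nat \<Rightarrow> 'y2 list \<Rightarrow> 'x2) \<Rightarrow>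
    'x1 list \<Rightarrow> ('y2 list \<times> 'y3 list) pmf" where
  "block_kernel N a x = map_pmf (block_out N a x) (noise N)"

definition dest_kernel :: "('x1, 'x2, 'y2, 'y3, 'z) relay_ibm \<Rightarrow> (nat \<Rightarrow> 'y2 list \<Rightarrow> 'x2) \<Rightarrow>
    'x1 list \<Rightarrow> 'y3 list pmf" where
  "dest_kernel N a x = map_pmf snd (block_kernel N a x)"

definition dest_out :: "('x1, 'x2, 'y2, 'y3, 'z) relay_ibm \<Rightarrow> (nat \<Rightarrow> 'y2 list \<Rightarrow> 'x2) \<Rightarrow>
    'x1 list \<Rightarrow> nat \<Rightarrow> 'z list \<Rightarrow> 'y3 list" where
  "dest_out N r x m zs = snd (snd (transmit N x r zs (m * block_length N)))"

lemma dest_out_Suc: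
  assumes L: "block_length N > 0" and "block_out N r (take (block_length N) x) z = (y2, y3)"
  shows "dest_out N r x (Suc m) (z # zs) =
    y3 @ dest_out N (\<lambda>i ys. r (block_length N + i) (y2 @ ys)) (drop (block_length N) x) m zs"
proof -
  obtain x2 where first: "transmit N (take (block_length N) x) r [z] (block_length N) = (x2, y2, y3)"
    using assms(2) by (cases "transmit N (take (block_length N) x) r [z] (block_length N)") (auto simp: block_out_def)
  obtain u2 v2 v3 where rest: "transmit N (drop (block_length N) x)
      (\<lambda>i ys. r (block_length N + i) (y2 @ ys)) zs (m * block_length N) = (u2, v2, v3)"
    by (metis prod_cases3)
  show ?thesis
    using transmit_append[OF L first rest] rest by (simp add: dest_out_def)
qed

lemma seqs_take: "x \<in> seqs A n \<Longrightarrow> k \<le> n \<Longrightarrow> take k x \<in> seqs A k"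
  by (auto simp: seqs_def)

lemma seqs_drop: "x \<in> seqs A n \<Longrightarrow> drop k x \<in> seqs (\<lambda>i. A (k + i)) (n - k)"
  by (auto simp: seqs_def)

lemma seqs_cong: "(\<And>i. i < n \<Longrightarrow> A i = B i) \<Longrightarrow> seqs A n = seqs B n"
  by (auto simp: seqs_def)

lemma finite_seqs:
  assumes "\<And>i. i < n \<Longrightarrow> finite (A i)"
  shows "finite (seqs A n)"
proof (rule finite_subset)
  show "seqs A n \<subseteq> {xs. set xs \<subseteq> (\<Union>i<n. A i) \<and> length xs = n}"
    by (force simp: seqs_def in_set_conv_nth)
  show "finite {xs. set xs \<subseteq> (\<Union>i<n. A i) \<and> length xs = n}"
    using assms by (intro finite_lists_length_eq) auto
qed

lemma seqs_nonempty:
  assumes "\<And>i. i < n \<Longrightarrow> A i \<noteq> {}"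
  shows "seqs A n \<noteq> {}"
proof -
  have "map (\<lambda>i. SOME x. x \<in> A i) [0..<n] \<in> seqs A n"
    using assms by (auto simp: seqs_def some_in_eq)
  thus ?thesis by blast
qed

text \<open>Elements of \<open>relay_codes\<close> are extensional, that is,
  \<open>undefined\<close> off the alphabets. The relay functions of a long code must be cut down to
  this form before they can serve as a value of \<open>A2\<close>.\<close>

definition restrict_relay :: "('x1, 'x2, 'y2, 'y3, 'z) relay_ibm \<Rightarrow> (nat \<Rightarrow> 'y2 list \<Rightarrow> 'x2) \<Rightarrow>
    nat \<Rightarrow> 'y2 list \<Rightarrow> 'x2" where
  "restrict_relay N r = (\<lambda>i\<in>{..<block_length N}. \<lambda>ys\<in>seqs (alph_Y2 N) i. r i ys)"

text \<open>Relay outputs that actually occur stay inside the alphabets, where both relays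
  agree.\<close>

lemma transmit_restrict_relay:
  assumes N: "relay_channel N" and x: "x \<in> seqs (alph_X1 N) (block_length N)"
    and a: "restrict_relay N r \<in> relay_codes N" and z: "z \<in> set_pmf (noise N)"
    and "k \<le> block_length N"
  shows "transmit N x r [z] k = transmit N x (restrict_relay N r) [z] k"
  using assms(5)
proof (induction k)
  case (Suc k)
  obtain p q s where t: "transmit N x (restrict_relay N r) [z] k = (p, q, s)"
    by (metis prod_cases3)
  have "q \<in> seqs (alph_Y2 N) k"
    using transmit_block_in_seqs[OF N x a z _ t] Suc.prems by simp
  hence "restrict_relay N r k q = r k q"
    using Suc.prems by (simp add: restrict_relay_def)
  thus ?case using Suc t by (auto simp: Let_def split: prod.splits)
qed auto

lemma block_out_in:
  assumes "relay_channel N" "x \<in> seqs (alph_X1 N) (block_length N)" "a \<in> relay_codes N"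
    "z \<in> set_pmf (noise N)"
  shows "block_out N a x z \<in> seqs (alph_Y2 N) (block_length N) \<times> seqs (alph_Y3 N) (block_length N)"
proof -
  obtain p q s where t: "transmit N x a [z] (block_length N) = (p, q, s)"
    by (metis prod_cases3)
  show ?thesis
    using transmit_block_in_seqs[OF assms order_refl t] by (simp add: block_out_def t)
qed

lemma relay_channel_finite:
  assumes "relay_channel N"
  shows "block_length N > 0" "finite (set_pmf (noise N))"
    "finite (seqs (alph_X1 N) (block_length N))" "seqs (alph_X1 N) (block_length N) \<noteq> {}"
    "finite (seqs (alph_Y2 N) (block_length N))" "finite (seqs (alph_Y3 N) (block_length N))"
    "finite (relay_codes N)" "relay_codes N \<noteq> {}"
proof -
  show "finite (relay_codes N)" unfolding relay_codes_def
    using assms by (intro finite_PiE finite_seqs) (auto simp: relay_channel_def)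
  show "relay_codes N \<noteq> {}"
    using assms by (auto simp: relay_codes_def PiE_eq_empty_iff relay_channel_def)
qed (use assms in \<open>auto simp: relay_channel_def intro!: finite_seqs seqs_nonempty\<close>)

text \<open>Under a point mass at \<open>a\<close> the event that \<open>A2\<close> equals
  \<open>a\<close> is certain, so the conditioning in the statement changes nothing and the joint
  law is the input law followed by the block channel.\<close>

lemma joint_fixed_code:
  assumes N: "relay_channel N" and P: "P \<in> input_pmfs N" and a: "a \<in> relay_codes N"
  defines "J \<equiv> joint N (pair_pmf P (return_pmf a))"
  shows "map_pmf (\<lambda>w. (rv_X1 w, (rv_Y2 w, rv_Y3 w))) J = bind_pmf P (\<lambda>x. map_pmf (Pair x) (block_kernel N a x))"
    and "w \<in> set_pmf J \<Longrightarrow> rv_A2 w = a"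
    and "finite (set_pmf J)"
proof -
  have P': "pair_pmf P (return_pmf a) \<in> input_code_pmfs N"
    using P a by (auto simp: input_code_pmfs_def input_pmfs_def)
  have J: "J = map_pmf (\<lambda>((x1, a), z). (x1, a, transmit N x1 a [z] (block_length N)))
      (pair_pmf (pair_pmf P (return_pmf a)) (noise N))"
    unfolding J_def by (rule joint_eq_transmit[OF N P'])
  also have "\<dots> = bind_pmf P (\<lambda>x. map_pmf (\<lambda>z. (x, a, transmit N x a [z] (block_length N))) (noise N))"
    by (simp add: pair_pmf_def map_bind_pmf bind_assoc_pmf bind_return_pmf map_pmf_def)
  finally have J': "J = bind_pmf P (\<lambda>x. map_pmf (\<lambda>z. (x, a, transmit N x a [z] (block_length N))) (noise N))" .
  show "map_pmf (\<lambda>w. (rv_X1 w, (rv_Y2 w, rv_Y3 w))) J = bind_pmf P (\<lambda>x. map_pmf (Pair x) (block_kernel N a x))"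
    unfolding J' block_kernel_def map_bind_pmf pmf.map_comp
    by (intro bind_pmf_cong map_pmf_cong refl)
       (auto simp: rv_X1_def rv_Y2_def rv_Y3_def block_out_def split: prod.splits)
  show "rv_A2 w = a" if "w \<in> set_pmf J" using that
    by (auto simp: J' rv_A2_def)
  have "finite (set_pmf P)"
    using P relay_channel_finite(3)[OF N] finite_subset by (auto simp: input_pmfs_def)
  thus "finite (set_pmf J)" using relay_channel_finite(2)[OF N] by (simp add: J')
qed

lemma cond_pmf_eq_self:
  assumes "set_pmf p \<subseteq> S"
  shows "cond_pmf p S = p"
proof (rule pmf_eqI)
  fix x
  have ne: "set_pmf p \<inter> S \<noteq> {}" using assms set_pmf_not_empty[of p] by blast
  have "measure_pmf.prob p S = 1"
    using assms by (auto simp: measure_pmf.prob_eq_1 AE_measure_pmf_iff)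
  thus "pmf (cond_pmf p S) x = pmf p x"
    using assms by (auto simp: pmf_cond[OF ne] set_pmf_iff)
qed

lemma info_eq_channel_information:
  assumes N: "relay_channel N" and P: "P \<in> input_pmfs N" and a: "a \<in> relay_codes N"
  shows "info_X1_Y3_given N (pair_pmf P (return_pmf a)) a =
    channel_information (seqs (alph_X1 N) (block_length N)) (seqs (alph_Y3 N) (block_length N)) (pmf P)
      (\<lambda>x. pmf (dest_kernel N a x))"
proof -
  let ?J = "joint N (pair_pmf P (return_pmf a))"
  note J = joint_fixed_code[OF N P a]
  have "cond_pmf ?J {w. rv_A2 w = a} = ?J"
    using J(2) by (intro cond_pmf_eq_self) auto
  moreover have "map_pmf (\<lambda>w. (rv_X1 w, rv_Y3 w)) ?J =
    map_pmf (\<lambda>(x, (y2, y3)). (x, y3)) (map_pmf (\<lambda>w. (rv_X1 w, (rv_Y2 w, rv_Y3 w))) ?J)"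
    by (simp add: pmf.map_comp o_def)
  hence "map_pmf (\<lambda>w. (rv_X1 w, rv_Y3 w)) ?J = bind_pmf P (\<lambda>x. map_pmf (Pair x) (dest_kernel N a x))"
    unfolding J(1) dest_kernel_def map_bind_pmf pmf.map_comp
    by (simp add: o_def case_prod_beta)
  ultimately show ?thesis unfolding info_X1_Y3_given_def
    using P N a relay_channel_finite[OF N] J(3) block_out_in[OF N _ a]
    by (simp, intro pmf_mutual_information_eq_channel_information)
      (fastforce simp: input_pmfs_def dest_kernel_def block_kernel_def)+
qed

section \<open>Reverse degradedness inside one block\<close>

lemma prob_bind_Pair:
  "measure_pmf.prob (bind_pmf P (\<lambda>x. map_pmf (Pair x) (K x))) ({x} \<times> S) = pmf P x * measure_pmf.prob (K x) S"
  "measure_pmf.prob (bind_pmf P (\<lambda>x. map_pmf (Pair x) (K x))) (UNIV \<times> S) = measure_pmf.prob (bind_pmf P K) S"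
proof -
  have "measure_pmf.prob (bind_pmf P (\<lambda>x. map_pmf (Pair x) (K x))) ({x} \<times> S) =
    (\<integral>v. indicator {x} v * measure_pmf.prob (K x) S \<partial>measure_pmf P)"
    unfolding measure_bind_pmf
    by (intro Bochner_Integration.integral_cong refl) (auto simp: indicator_def vimage_def)
  thus "measure_pmf.prob (bind_pmf P (\<lambda>x. map_pmf (Pair x) (K x))) ({x} \<times> S) = pmf P x * measure_pmf.prob (K x) S"
    by (simp add: pmf.rep_eq)
  show "measure_pmf.prob (bind_pmf P (\<lambda>x. map_pmf (Pair x) (K x))) (UNIV \<times> S) = measure_pmf.prob (bind_pmf P K) S"
    unfolding measure_bind_pmf
    by (intro Bochner_Integration.integral_cong refl) (auto simp: vimage_def)
qed

text \<open>The Markov property with denominators cleared: P(x, y2, y3) P(y3) = P(x, y3) P(y2, y3).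
  The point mass at \<open>a\<close> turns conditioning on the pair of \<open>A2\<close> and
  \<open>Y3\<close> into conditioning on \<open>Y3\<close>.\<close>

lemma degraded_factorization:
  assumes N: "relay_channel N" and deg: "reversely_degraded N"
    and P: "P \<in> input_pmfs N" and a: "a \<in> relay_codes N"
  shows "pmf P x * pmf (block_kernel N a x) (y2, y3) * pmf (bind_pmf P (dest_kernel N a)) y3 =
    pmf P x * pmf (dest_kernel N a x) y3 * pmf (bind_pmf P (block_kernel N a)) (y2, y3)"
proof -
  let ?J = "joint N (pair_pmf P (return_pmf a))"
  let ?K = "block_kernel N a"
  let ?J' = "bind_pmf P (\<lambda>x. map_pmf (Pair x) (?K x))"
  note J = joint_fixed_code[OF N P a]
  have "pair_pmf P (return_pmf a) \<in> input_code_pmfs N"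
    using P a by (auto simp: input_code_pmfs_def input_pmfs_def)
  hence mc: "markov_chain ?J rv_X1 (\<lambda>w. (rv_A2 w, rv_Y3 w)) rv_Y2"
    using deg by (auto simp: reversely_degraded_def)
  have ev: "measure_pmf.prob ?J {w. F (rv_X1 w) (rv_Y2 w) (rv_Y3 w) \<and> rv_A2 w = a} =
    measure_pmf.prob ?J' {(x, y2, y3). F x y2 y3}" for F
  proof -
    have "measure_pmf.prob ?J {w. F (rv_X1 w) (rv_Y2 w) (rv_Y3 w) \<and> rv_A2 w = a} =
      measure_pmf.prob ?J {w. F (rv_X1 w) (rv_Y2 w) (rv_Y3 w)}"
      using J(2) by (intro measure_pmf.finite_measure_eq_AE) (auto simp: AE_measure_pmf_iff)
    also have "\<dots> = measure_pmf.prob ?J' {(x, y2, y3). F x y2 y3}"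
      unfolding J(1)[symmetric] measure_map_pmf by (rule arg_cong[where f = "measure _"]) auto
    finally show ?thesis .
  qed
  define q3 where "q3 = pmf (bind_pmf P (dest_kernel N a)) y3"
  define p13 where "p13 = pmf P x * pmf (dest_kernel N a x) y3"
  define p123 where "p123 = pmf P x * pmf (block_kernel N a x) (y2, y3)"
  define q23 where "q23 = pmf (bind_pmf P (block_kernel N a)) (y2, y3)"
  have dest: "bind_pmf P (dest_kernel N a) = map_pmf snd (bind_pmf P ?K)"
    by (simp add: dest_kernel_def[abs_def] map_bind_pmf)
  have UNIV3: "{(x' :: 'a list, y2' :: 'c list, y3'). y3' = y3} = UNIV \<times> (snd -` {y3})" by auto
  have "measure_pmf.prob ?J' {(x', y2', y3'). y3' = y3} = q3"
    using prob_bind_Pair(2)[of P ?K "snd -` {y3}"]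
    by (simp add: UNIV3 q3_def dest pmf_map)
  with ev[of "\<lambda>_ _ v. v = y3"]
  have 1: "measure_pmf.prob ?J {w. rv_Y3 w = y3 \<and> rv_A2 w = a} = q3" by simp
  have "{(x', y2', y3'). x' = x \<and> y3' = y3} = {x} \<times> (snd -` {y3} :: ('c list \<times> 'd list) set)" by auto
  with ev[of "\<lambda>u _ v. u = x \<and> v = y3"] prob_bind_Pair(1)[of P ?K x "snd -` {y3}"]
  have 2: "measure_pmf.prob ?J {w. (rv_X1 w = x \<and> rv_Y3 w = y3) \<and> rv_A2 w = a} = p13"
    by (simp add: p13_def pmf.rep_eq dest_kernel_def)
  have "{(x', y2', y3'). y2' = y2 \<and> y3' = y3} = (UNIV :: 'a list set) \<times> {(y2, y3)}" by auto
  with ev[of "\<lambda>_ u v. u = y2 \<and> v = y3"] prob_bind_Pair(2)[of P ?K "{(y2, y3)}"]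
  have 3: "measure_pmf.prob ?J {w. (rv_Y2 w = y2 \<and> rv_Y3 w = y3) \<and> rv_A2 w = a} = q23"
    by (simp add: q23_def pmf.rep_eq)
  have "{(x', y2', y3'). x' = x \<and> y2' = y2 \<and> y3' = y3} = {x} \<times> {(y2, y3)}" by auto
  with ev[of "\<lambda>t u v. t = x \<and> u = y2 \<and> v = y3"] prob_bind_Pair(1)[of P ?K x "{(y2, y3)}"]
  have 4: "measure_pmf.prob ?J {w. (rv_X1 w = x \<and> rv_Y2 w = y2 \<and> rv_Y3 w = y3) \<and> rv_A2 w = a} = p123"
    by (simp add: p123_def pmf.rep_eq)
  have "p123 / q3 = p13 / q3 * (q23 / q3)"
    using mc[unfolded markov_chain_def cond_prob_def, rule_format, of x y2 "(a, y3)"] 1 2 3 4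
    by (simp add: conj_ac)
  \<comment> \<open>If \<open>q3 = 0\<close>, the Markov equation reads 0 = 0 because of the default
    value of conditional probabilities; this inequality then forces \<open>p13 = 0\<close>, and the
    product form still holds.\<close>
  moreover have "p13 \<le> q3"
    unfolding 1[symmetric] 2[symmetric] by (intro measure_pmf.finite_measure_mono) auto
  moreover have "p13 \<ge> 0" by (simp add: p13_def)
  ultimately have "p123 * q3 = p13 * q23"
    by (cases "q3 = 0") (auto simp: divide_simps)
  thus ?thesis by (simp add: p123_def p13_def q3_def q23_def)
qed

text \<open>Wherever \<open>p x * V x (y2, y3)\<close> is positive, \<open>deg\<close> says that the
  likelihood ratio of the pair equals that of \<open>y3\<close> alone. In the average log-likelihood
  ratio \<open>y2\<close> can then be summed out.\<close>

lemma channel_information_degraded: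
  assumes fin: "finite A" "finite B2" "finite B3" and p: "\<And>x. x \<in> A \<Longrightarrow> p x \<ge> 0"
    and V: "\<And>x y. x \<in> A \<Longrightarrow> V x y \<ge> 0"
    and V3: "\<And>x y3. x \<in> A \<Longrightarrow> y3 \<in> B3 \<Longrightarrow> V3 x y3 = (\<Sum>y2\<in>B2. V x (y2, y3))"
    and deg: "\<And>x y2 y3. x \<in> A \<Longrightarrow> y2 \<in> B2 \<Longrightarrow> y3 \<in> B3 \<Longrightarrow>
      p x * V x (y2, y3) * (\<Sum>x\<in>A. p x * V3 x y3) = p x * V3 x y3 * (\<Sum>x\<in>A. p x * V x (y2, y3))"
  shows "channel_information A (B2 \<times> B3) p V = channel_information A B3 p V3"
proof -
  define Q where "Q y = (\<Sum>x\<in>A. p x * V x y)" for y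
  define Q3 where "Q3 y = (\<Sum>x\<in>A. p x * V3 x y)" for y
  have V3nn: "V3 x y3 \<ge> 0" if "x \<in> A" "y3 \<in> B3" for x y3
    using V3[OF that] V[OF that(1)] by (simp add: sum_nonneg)
  have *: "p x * V x (y2, y3) * log 2 (V x (y2, y3) / Q (y2, y3)) =
      p x * V x (y2, y3) * log 2 (V3 x y3 / Q3 y3)"
    if "x \<in> A" "y2 \<in> B2" "y3 \<in> B3" for x y2 y3
  proof (cases "p x * V x (y2, y3) = 0")
    case False
    hence pos: "p x > 0" "V x (y2, y3) > 0"
      using p[OF that(1)] V[OF that(1), of "(y2, y3)"] by (auto simp: less_le)
    have "0 < p x * V x (y2, y3)" using pos by simp
    also have "\<dots> \<le> Q (y2, y3)"
      unfolding Q_def using that p V fin by (intro member_le_sum) auto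
    finally have "Q (y2, y3) > 0" .
    have "0 < V x (y2, y3)" by fact
    also have "V x (y2, y3) \<le> V3 x y3"
      unfolding V3[OF that(1,3)] using that V fin by (intro member_le_sum) auto
    finally have "0 < p x * V3 x y3" using pos by simp
    also have "\<dots> \<le> Q3 y3"
      unfolding Q3_def using that p V3nn fin by (intro member_le_sum) auto
    finally have "Q3 y3 > 0" .
    have "p x * (V x (y2, y3) * Q3 y3) = p x * (V3 x y3 * Q (y2, y3))"
      using deg[OF that] by (simp add: Q_def Q3_def mult_ac)
    hence "V x (y2, y3) / Q (y2, y3) = V3 x y3 / Q3 y3"
      using pos \<open>Q (y2, y3) > 0\<close> \<open>Q3 y3 > 0\<close> by (simp add: field_simps)
    thus ?thesis by simp
  qed auto
  have "channel_information A (B2 \<times> B3) p V = (\<Sum>x\<in>A. \<Sum>y\<in>B2 \<times> B3. p x * V x y * log 2 (V x y / Q y))"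
    unfolding Q_def using fin p V by (intro channel_information_log_form) auto
  also have "\<dots> = (\<Sum>x\<in>A. \<Sum>y2\<in>B2. \<Sum>y3\<in>B3. p x * V x (y2, y3) * log 2 (V x (y2, y3) / Q (y2, y3)))"
    by (simp add: sum.cartesian_product case_prod_beta)
  also have "\<dots> = (\<Sum>x\<in>A. \<Sum>y2\<in>B2. \<Sum>y3\<in>B3. p x * V x (y2, y3) * log 2 (V3 x y3 / Q3 y3))"
    by (intro sum.cong refl *)
  also have "\<dots> = (\<Sum>x\<in>A. \<Sum>y3\<in>B3. p x * V3 x y3 * log 2 (V3 x y3 / Q3 y3))"
  proof (intro sum.cong refl)
    fix x assume "x \<in> A"
    show "(\<Sum>y2\<in>B2. \<Sum>y3\<in>B3. p x * V x (y2, y3) * log 2 (V3 x y3 / Q3 y3)) =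
      (\<Sum>y3\<in>B3. p x * V3 x y3 * log 2 (V3 x y3 / Q3 y3))"
      by (subst sum.swap)
         (auto simp: V3[OF \<open>x \<in> A\<close>] sum_distrib_left sum_distrib_right intro!: sum.cong)
  qed
  also have "\<dots> = channel_information A B3 p V3"
    unfolding Q3_def using fin p V3nn by (intro channel_information_log_form[symmetric]) auto
  finally show ?thesis .
qed

lemma pmf_bind_sum:
  assumes "finite A" "set_pmf p \<subseteq> A"
  shows "pmf (bind_pmf p K) y = (\<Sum>x\<in>A. pmf p x * pmf (K x) y)"
  using assms by (auto simp: pmf_bind intro!: integral_measure_pmf[THEN trans])

text \<open>Revealing \<open>Y2\<close> to the destination costs nothing. This is how degradedness
  enters the converse, where \<open>P\<close> is the law of a block under a posterior of the
  message.\<close>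

lemma channel_information_block_kernel:
  assumes N: "relay_channel N" and deg: "reversely_degraded N"
    and P: "P \<in> input_pmfs N" and a: "a \<in> relay_codes N"
  shows "channel_information (seqs (alph_X1 N) (block_length N))
      (seqs (alph_Y2 N) (block_length N) \<times> seqs (alph_Y3 N) (block_length N)) (pmf P)
      (\<lambda>x. pmf (block_kernel N a x)) = info_X1_Y3_given N (pair_pmf P (return_pmf a)) a"
  unfolding info_eq_channel_information[OF N P a]
proof (rule channel_information_degraded)
  let ?A = "seqs (alph_X1 N) (block_length N)"
  let ?B2 = "seqs (alph_Y2 N) (block_length N)"
  note bind = pmf_bind_sum[OF relay_channel_finite(3)[OF N]]
  show "pmf P x * pmf (block_kernel N a x) (y2, y3) *
      (\<Sum>x\<in>?A. pmf P x * pmf (dest_kernel N a x) y3) =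
    pmf P x * pmf (dest_kernel N a x) y3 * (\<Sum>x\<in>?A. pmf P x * pmf (block_kernel N a x) (y2, y3))"
    for x y2 y3
    using degraded_factorization[OF N deg P a, of x y2 y3] P by (simp add: bind input_pmfs_def)
  fix x y3 assume x: "x \<in> ?A"
  have sub: "set_pmf (block_kernel N a x) \<subseteq> ?B2 \<times> seqs (alph_Y3 N) (block_length N)"
    using block_out_in[OF N x a] by (simp add: block_kernel_def image_subset_iff)
  have "pmf (dest_kernel N a x) y3 = measure_pmf.prob (block_kernel N a x) (snd -` {y3})"
    by (simp add: dest_kernel_def pmf_map)
  also have "\<dots> = measure_pmf.prob (block_kernel N a x) ((\<lambda>y2. (y2, y3)) ` ?B2)"
    using sub by (intro measure_pmf.finite_measure_eq_AE) (force simp: AE_measure_pmf_iff)+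
  also have "\<dots> = (\<Sum>y2\<in>?B2. pmf (block_kernel N a x) (y2, y3))"
    using relay_channel_finite(5)[OF N]
    by (subst measure_measure_pmf_finite) (auto simp: sum.reindex inj_on_def)
  finally show "pmf (dest_kernel N a x) y3 = (\<Sum>y2\<in>?B2. pmf (block_kernel N a x) (y2, y3))" .
qed (use relay_channel_finite[OF N] in auto)

section \<open>Converse\<close>

text \<open>For \<open>\<mu>\<close> of total mass \<open>1\<close> this is minus the entropy; it is homogeneous of degree \<open>1\<close> in \<open>\<mu>\<close>,
  so that posteriors need not be normalized.\<close>

definition neg_entropy :: "'w set \<Rightarrow> ('w \<Rightarrow> real) \<Rightarrow> real" where
  "neg_entropy W \<mu> = (\<Sum>w\<in>W. xlog (\<mu> w)) - xlog (\<Sum>w\<in>W. \<mu> w)"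

text \<open>Nonnegativity of relative entropy, scaled by the total mass \<open>s\<close> of
  \<open>\<mu>\<close>: apply ln t \<le> t - 1 pointwise at t = \<open>q w * s / \<mu> w\<close>. In
  the converse log \<open>q\<close> is the score of a guess at the message.\<close>

lemma gibbs_neg_entropy:
  assumes "finite W" and \<mu>: "\<And>w. w \<in> W \<Longrightarrow> \<mu> w \<ge> 0"
    and q: "\<And>w. w \<in> W \<Longrightarrow> q w > 0" "(\<Sum>w\<in>W. q w) \<le> 1"
  shows "(\<Sum>w\<in>W. \<mu> w * log 2 (q w)) \<le> neg_entropy W \<mu>"
proof -
  define s where "s = (\<Sum>w\<in>W. \<mu> w)"
  have s: "s \<ge> 0" unfolding s_def using \<mu> by (intro sum_nonneg) auto
  have "\<mu> w * log 2 (q w) - xlog (\<mu> w) + \<mu> w * log 2 s \<le> (q w * s - \<mu> w) / ln 2"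
    if w: "w \<in> W" for w
  proof (cases "\<mu> w = 0")
    case True
    thus ?thesis using q(1)[OF w] s by (simp add: xlog_def)
  next
    case False
    hence pos: "\<mu> w > 0" using \<mu>[OF w] by simp
    also have "\<mu> w \<le> s" unfolding s_def using w \<mu> assms(1) by (intro member_le_sum) auto
    finally have "s > 0" .
    have "\<mu> w * log 2 (q w) - xlog (\<mu> w) + \<mu> w * log 2 s = \<mu> w * ln (q w * s / \<mu> w) / ln 2"
      using pos \<open>s > 0\<close> q(1)[OF w] by (simp add: xlog_def log_def ln_mult ln_div field_simps)
    also have "\<dots> \<le> \<mu> w * (q w * s / \<mu> w - 1) / ln 2"
      using pos \<open>s > 0\<close> q(1)[OF w] by (intro divide_right_mono mult_left_mono ln_le_minus_one) auto
    also have "\<dots> = (q w * s - \<mu> w) / ln 2" using pos by (simp add: field_simps)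
    finally show ?thesis .
  qed
  hence "(\<Sum>w\<in>W. \<mu> w * log 2 (q w) - xlog (\<mu> w) + \<mu> w * log 2 s) \<le> (\<Sum>w\<in>W. (q w * s - \<mu> w) / ln 2)"
    by (rule sum_mono)
  also have "\<dots> = ((\<Sum>w\<in>W. q w) * s - s) / ln 2"
    by (simp add: sum_divide_distrib[symmetric] sum_subtractf sum_distrib_right s_def)
  also have "\<dots> \<le> 0" using q(2) s mult_right_mono[OF q(2) s] by (simp add: divide_nonpos_pos)
  finally show ?thesis
    by (simp add: neg_entropy_def sum.distrib sum_subtractf s_def[symmetric] sum_distrib_right[symmetric])
       (simp add: xlog_def)
qed

text \<open>This is H(W) - H(W | Y) = I(W; Y) times the total mass. The weights
  \<open>\<mu> w * V w y\<close> form the unnormalized posterior given \<open>y\<close>, and by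
  homogeneity its \<open>neg_entropy\<close> already carries the probability of \<open>y\<close> as
  a factor.\<close>

lemma neg_entropy_posteriors:
  assumes "finite W" "finite Y" and \<mu>: "\<And>w. w \<in> W \<Longrightarrow> \<mu> w \<ge> 0"
    and V: "\<And>w y. w \<in> W \<Longrightarrow> V w y \<ge> 0" "\<And>w. w \<in> W \<Longrightarrow> (\<Sum>y\<in>Y. V w y) = 1"
    and bound: "(\<Sum>w\<in>W. \<mu> w) > 0 \<Longrightarrow> channel_information W Y (\<lambda>w. \<mu> w / (\<Sum>w\<in>W. \<mu> w)) V \<le> C"
  shows "(\<Sum>y\<in>Y. neg_entropy W (\<lambda>w. \<mu> w * V w y)) \<le> neg_entropy W \<mu> + C * (\<Sum>w\<in>W. \<mu> w)"
proof -
  define s where "s = (\<Sum>w\<in>W. \<mu> w)"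
  have s: "s \<ge> 0" unfolding s_def using \<mu> by (intro sum_nonneg) auto
  show ?thesis
  proof (cases "s = 0")
    case True
    hence "\<mu> w = 0" if "w \<in> W" for w
      using that \<mu> assms(1) unfolding s_def by (subst (asm) sum_nonneg_eq_0_iff) auto
    thus ?thesis by (simp add: neg_entropy_def xlog_def)
  next
    case False
    hence s: "s > 0" using s by simp
    define Q where "Q y = (\<Sum>w\<in>W. \<mu> w / s * V w y)" for y
    have Q: "Q y \<ge> 0" for y unfolding Q_def using \<mu> V s by (intro sum_nonneg) auto
    have Qsum: "(\<Sum>y\<in>Y. Q y) = 1"
      unfolding Q_def by (subst sum.swap)
        (use V(2) s in \<open>simp add: sum_distrib_left[symmetric] sum_divide_distrib[symmetric] s_def\<close>)
    \<comment> \<open>The product rule for \<open>xlog\<close> holds at 0 too; since each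
      \<open>V w\<close> sums to 1, the prior terms come back unchanged.\<close>
    have 1: "(\<Sum>y\<in>Y. \<Sum>w\<in>W. xlog (\<mu> w * V w y)) =
        (\<Sum>w\<in>W. \<mu> w * (\<Sum>y\<in>Y. xlog (V w y))) + (\<Sum>w\<in>W. xlog (\<mu> w))"
    proof -
      have "(\<Sum>y\<in>Y. \<Sum>w\<in>W. xlog (\<mu> w * V w y)) =
          (\<Sum>w\<in>W. \<Sum>y\<in>Y. \<mu> w * xlog (V w y) + V w y * xlog (\<mu> w))"
        by (subst sum.swap) (use \<mu> V in \<open>auto intro!: sum.cong simp: xlog_mult\<close>)
      also have "\<dots> = (\<Sum>w\<in>W. \<mu> w * (\<Sum>y\<in>Y. xlog (V w y)) + xlog (\<mu> w))"
        using V(2) by (intro sum.cong refl)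
          (simp add: sum.distrib sum_distrib_left sum_distrib_right[symmetric])
      finally show ?thesis by (simp add: sum.distrib)
    qed
    have 2: "(\<Sum>y\<in>Y. xlog (\<Sum>w\<in>W. \<mu> w * V w y)) = s * (\<Sum>y\<in>Y. xlog (Q y)) + xlog s"
    proof -
      have "(\<Sum>w\<in>W. \<mu> w * V w y) = s * Q y" for y
        using s by (simp add: Q_def sum_distrib_left)
      hence "(\<Sum>y\<in>Y. xlog (\<Sum>w\<in>W. \<mu> w * V w y)) = (\<Sum>y\<in>Y. s * xlog (Q y) + Q y * xlog s)"
        using s Q by (simp add: xlog_mult)
      also have "\<dots> = s * (\<Sum>y\<in>Y. xlog (Q y)) + xlog s"
        using Qsum by (simp add: sum.distrib sum_distrib_left sum_distrib_right[symmetric])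
      finally show ?thesis .
    qed
    have "(\<Sum>w\<in>W. \<mu> w * (\<Sum>y\<in>Y. xlog (V w y))) - s * (\<Sum>y\<in>Y. xlog (Q y)) =
        s * channel_information W Y (\<lambda>w. \<mu> w / s) V"
      using s by (simp add: channel_information_def Q_def right_diff_distrib sum_distrib_left)
    also have "\<dots> \<le> s * C"
      using bound s by (intro mult_left_mono) (auto simp: s_def)
    finally show ?thesis
      by (simp add: neg_entropy_def sum_subtractf 1 2 s_def[symmetric] mult.commute)
  qed
qed

lemma sum_map_pmf:
  fixes f :: "'b \<Rightarrow> real"
  assumes "finite W" "finite A" "set_pmf p \<subseteq> W" "g ` W \<subseteq> A"
  shows "(\<Sum>x\<in>A. pmf (map_pmf g p) x * f x) = (\<Sum>w\<in>W. pmf p w * f (g w))"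
proof -
  have "(\<Sum>w\<in>W. pmf p w * f (g w)) = measure_pmf.expectation p (\<lambda>w. f (g w))"
    using assms by (subst integral_measure_pmf[of W]) auto
  also have "\<dots> = measure_pmf.expectation (map_pmf g p) f" by simp
  also have "\<dots> = (\<Sum>x\<in>A. pmf (map_pmf g p) x * f x)"
    using assms by (subst integral_measure_pmf[of A]) auto
  finally show ?thesis by simp
qed

text \<open>The output depends on the message only through the transmitted block \<open>g w\<close>,
  so I(W; Y) = I(g(W); Y), also when several messages share a block.\<close>

lemma channel_information_map_pmf:
  assumes "finite W" "finite A" "set_pmf p \<subseteq> W" "g ` W \<subseteq> A"
  shows "channel_information W Y (pmf p) (\<lambda>w. K (g w)) = channel_information A Y (pmf (map_pmf g p)) K"
  unfolding channel_information_def sum_map_pmf[OF assms, of "\<lambda>x. \<Sum>y\<in>Y. xlog (K x y)"]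
  using sum_map_pmf[OF assms, of "\<lambda>x. K x _"] by simp

lemma finite_replicate_pmf:
  assumes "finite (set_pmf p)"
  shows "finite (set_pmf (replicate_pmf k p))"
proof -
  have "set_pmf (replicate_pmf k p) = {xs. set xs \<subseteq> set_pmf p \<and> length xs = k}"
    by (auto simp: set_replicate_pmf)
  thus ?thesis using assms by (simp add: finite_lists_length_eq)
qed

lemma expectation_replicate_Suc:
  fixes f :: "'a list \<Rightarrow> real"
  assumes "finite (set_pmf p)"
  shows "measure_pmf.expectation (replicate_pmf (Suc m) p) f =
    measure_pmf.expectation p (\<lambda>z. measure_pmf.expectation (replicate_pmf m p) (\<lambda>zs. f (z # zs)))"
proof -
  have "replicate_pmf (Suc m) p = bind_pmf p (\<lambda>z. map_pmf ((#) z) (replicate_pmf m p))"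
    by (simp add: map_pmf_def)
  thus ?thesis using assms finite_replicate_pmf[OF assms] by (simp add: expectation_bind_pmf_finite del: replicate_pmf.simps)
qed

lemma restrict_relay_in_codes:
  assumes "\<And>t ys. t < block_length N \<Longrightarrow> ys \<in> seqs (alph_Y2 N) t \<Longrightarrow> r t ys \<in> alph_X2 N t"
  shows "restrict_relay N r \<in> relay_codes N"
  using assms by (auto simp: restrict_relay_def relay_codes_def PiE_iff)

text \<open>Core of the converse. Everything that varies is generalized in the induction: after a
  first output \<open>y\<close> the prior becomes \<open>\<mu> w * V w y\<close>, the encoder loses
  its first block, the relay functions get the relay part of \<open>y\<close> in front of their
  argument and the guess gets the destination part. These are data of the same kind for one block
  less, and \<open>neg_entropy_posteriors\<close> pays at most \<open>C\<close> per unit of mass for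
  the block removed.\<close>

lemma score_le_neg_entropy:
  fixes N :: "('x1, 'x2, 'y2, 'y3, 'z) relay_ibm" and W :: "'w set"
  defines "L \<equiv> block_length N"
  assumes N: "relay_channel N" and deg: "reversely_degraded N"
    and C: "\<And>a P. a \<in> relay_codes N \<Longrightarrow> P \<in> input_pmfs N \<Longrightarrow>
      info_X1_Y3_given N (pair_pmf P (return_pmf a)) a \<le> C"
    and W: "finite W" and \<mu>: "\<And>w. w \<in> W \<Longrightarrow> \<mu> w \<ge> 0"
    and enc: "\<And>w. w \<in> W \<Longrightarrow> enc w \<in> seqs (\<lambda>t. alph_X1 N (t mod L)) (m * L)"
    and rel: "\<And>t ys. t < m * L \<Longrightarrow> ys \<in> seqs (\<lambda>t. alph_Y2 N (t mod L)) t \<Longrightarrow> r t ys \<in> alph_X2 N (t mod L)"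
    and q: "\<And>y w. w \<in> W \<Longrightarrow> q y w > 0" "\<And>y. (\<Sum>w\<in>W. q y w) \<le> 1"
  shows "(\<Sum>w\<in>W. \<mu> w * measure_pmf.expectation (replicate_pmf m (noise N))
      (\<lambda>zs. log 2 (q (dest_out N r (enc w) m zs) w))) \<le> neg_entropy W \<mu> + real m * C * (\<Sum>w\<in>W. \<mu> w)"
  using \<mu> enc rel q
proof (induction m arbitrary: \<mu> enc r q)
  case 0
  show ?case
    using gibbs_neg_entropy[OF W 0(1), where q = "q []"] 0(4,5) by (simp add: dest_out_def)
next
  case (Suc m)
  note fin = relay_channel_finite[OF N, folded L_def]
  let ?A = "seqs (alph_X1 N) L"
  let ?B2 = "seqs (alph_Y2 N) L"
  let ?Y = "?B2 \<times> seqs (alph_Y3 N) L"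
  \<comment> \<open>Nothing precedes the first block, so the relay acts in it through this single
    block code function, whatever the message is.\<close>
  define a where "a = restrict_relay N r"
  define x where "x w = take L (enc w)" for w
  have modY2: "seqs (\<lambda>t. alph_Y2 N (t mod L)) k = seqs (alph_Y2 N) k" if "k \<le> L" for k
    using that by (intro seqs_cong) auto
  have a: "a \<in> relay_codes N"
    unfolding a_def
  proof (rule restrict_relay_in_codes)
    fix t ys assume "t < block_length N" "ys \<in> seqs (alph_Y2 N) t"
    thus "r t ys \<in> alph_X2 N t"
      using Suc.prems(3)[of t ys] modY2[of t] by (auto simp: L_def)
  qed
  have x: "x w \<in> ?A" if "w \<in> W" for w
    using seqs_take[OF Suc.prems(2)[OF that], of L] seqs_cong[of L "\<lambda>t. alph_X1 N (t mod L)" "alph_X1 N"]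
    by (simp add: x_def)
  define V where "V w y = pmf (block_kernel N a (x w)) y" for w y
  have outY: "block_out N a (x w) z \<in> ?Y" if "w \<in> W" "z \<in> set_pmf (noise N)" for w z
    using block_out_in[OF N _ a that(2)] x[OF that(1)] by (simp add: L_def)
  have suppV: "set_pmf (block_kernel N a (x w)) \<subseteq> ?Y" if "w \<in> W" for w
    using outY[OF that] by (simp add: block_kernel_def image_subset_iff)
  define r' where "r' y2 = (\<lambda>i ys. r (L + i) (y2 @ ys))" for y2
  define score where "score y w = measure_pmf.expectation (replicate_pmf m (noise N))
      (\<lambda>zs. log 2 (q (snd y @ dest_out N (r' (fst y)) (drop L (enc w)) m zs) w))" for y w
  have split: "measure_pmf.expectation (replicate_pmf (Suc m) (noise N))
      (\<lambda>zs. log 2 (q (dest_out N r (enc w) (Suc m) zs) w)) = (\<Sum>y\<in>?Y. V w y * score y w)"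
    if w: "w \<in> W" for w
  proof -
    have "measure_pmf.expectation (replicate_pmf (Suc m) (noise N))
        (\<lambda>zs. log 2 (q (dest_out N r (enc w) (Suc m) zs) w)) =
      measure_pmf.expectation (noise N) (\<lambda>z. score (block_out N a (x w) z) w)"
      unfolding expectation_replicate_Suc[OF fin(2)]
    proof (rule expectation_cong_on)
      fix z assume z: "z \<in> set_pmf (noise N)"
      have "block_out N r (x w) z = block_out N a (x w) z"
        unfolding block_out_def a_def
        using transmit_restrict_relay[OF N _ a[unfolded a_def] z order_refl] x[OF w]
        by (simp add: L_def)
      hence "block_out N r (take (block_length N) (enc w)) z =
          (fst (block_out N a (x w) z), snd (block_out N a (x w) z))"
        by (simp add: x_def L_def)
      from dest_out_Suc[OF _ this]
      show "measure_pmf.expectation (replicate_pmf m (noise N))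
          (\<lambda>zs. log 2 (q (dest_out N r (enc w) (Suc m) (z # zs)) w)) = score (block_out N a (x w) z) w"
        using fin(1) by (simp add: score_def r'_def L_def)
    qed
    also have "\<dots> = measure_pmf.expectation (block_kernel N a (x w)) (\<lambda>y. score y w)"
      by (simp add: block_kernel_def)
    also have "\<dots> = (\<Sum>y\<in>?Y. V w y * score y w)"
      using suppV[OF w] fin by (subst integral_measure_pmf[of ?Y]) (auto simp: V_def)
    finally show ?thesis .
  qed
  have V: "V w y \<ge> 0" for w y by (simp add: V_def)
  have V1: "(\<Sum>y\<in>?Y. V w y) = 1" if "w \<in> W" for w
    unfolding V_def using suppV[OF that] fin by (intro sum_pmf_eq_1) auto
  have IH: "(\<Sum>w\<in>W. \<mu> w * V w y * score y w) \<le>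
      neg_entropy W (\<lambda>w. \<mu> w * V w y) + real m * C * (\<Sum>w\<in>W. \<mu> w * V w y)"
    if y: "y \<in> ?Y" for y
    unfolding score_def
  proof (rule Suc.IH)
    fix w assume w: "w \<in> W"
    show "0 \<le> \<mu> w * V w y" using Suc.prems(1)[OF w] V by simp
    show "drop L (enc w) \<in> seqs (\<lambda>t. alph_X1 N (t mod L)) (m * L)"
      using seqs_drop[OF Suc.prems(2)[OF w], of L] by simp
    show "q (snd y @ y') w > 0" for y' using Suc.prems(4)[OF w] .
  next
    fix t ys assume t: "t < m * L" "ys \<in> seqs (\<lambda>t. alph_Y2 N (t mod L)) t"
    have "fst y \<in> ?B2" using y by auto
    hence "fst y @ ys \<in> seqs (\<lambda>t. alph_Y2 N (t mod L)) (L + t)"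
      using t(2) by (auto simp: seqs_def nth_append le_mod_geq)
    thus "r' (fst y) t ys \<in> alph_X2 N (t mod L)"
      using Suc.prems(3)[of "L + t" "fst y @ ys"] t(1) by (simp add: r'_def)
  next
    show "(\<Sum>w\<in>W. q (snd y @ y') w) \<le> 1" for y' by (rule Suc.prems(5))
  qed
  \<comment> \<open>Here the weights are normalized. The image of the posterior under
    \<open>x\<close> is a legitimate input law of the block, and \<open>C\<close> bounds the
    information for all of these.\<close>
  have bound: "channel_information W ?Y (\<lambda>w. \<mu> w / (\<Sum>w\<in>W. \<mu> w)) V \<le> C" if s: "(\<Sum>w\<in>W. \<mu> w) > 0"
  proof -
    define f where "f w = (if w \<in> W then \<mu> w / (\<Sum>w\<in>W. \<mu> w) else 0)" for w
    have "sum f W = 1" using s by (simp add: f_def sum_divide_distrib[symmetric])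
    then obtain p where p: "pmf p = f" "set_pmf p \<subseteq> W"
      using pmf_of_simplex[OF W, of f] Suc.prems(1) s by (auto simp: f_def)
    have "channel_information W ?Y (\<lambda>w. \<mu> w / (\<Sum>w\<in>W. \<mu> w)) V = channel_information W ?Y (pmf p) V"
      unfolding p(1) by (simp add: channel_information_def f_def)
    also have "\<dots> = channel_information ?A ?Y (pmf (map_pmf x p)) (\<lambda>x. pmf (block_kernel N a x))"
      unfolding V_def using W fin p x by (intro channel_information_map_pmf) auto
    also have "\<dots> = info_X1_Y3_given N (pair_pmf (map_pmf x p) (return_pmf a)) a"
      unfolding L_def using p x by (intro channel_information_block_kernel N deg a) (auto simp: input_pmfs_def L_def)
    also have "\<dots> \<le> C"
      using p x by (intro C a) (auto simp: input_pmfs_def L_def)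
    finally show ?thesis .
  qed
  have "(\<Sum>w\<in>W. \<mu> w * measure_pmf.expectation (replicate_pmf (Suc m) (noise N))
      (\<lambda>zs. log 2 (q (dest_out N r (enc w) (Suc m) zs) w))) =
      (\<Sum>w\<in>W. \<mu> w * (\<Sum>y\<in>?Y. V w y * score y w))"
    by (intro sum.cong refl) (simp only: split)
  also have "\<dots> = (\<Sum>y\<in>?Y. \<Sum>w\<in>W. \<mu> w * V w y * score y w)"
    by (subst sum.swap) (simp add: sum_distrib_left mult.assoc)
  also have "\<dots> \<le> (\<Sum>y\<in>?Y. neg_entropy W (\<lambda>w. \<mu> w * V w y) + real m * C * (\<Sum>w\<in>W. \<mu> w * V w y))"
    by (intro sum_mono IH)
  also have "\<dots> = (\<Sum>y\<in>?Y. neg_entropy W (\<lambda>w. \<mu> w * V w y)) + real m * C * (\<Sum>w\<in>W. \<mu> w)"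
  proof -
    have "(\<Sum>y\<in>?Y. \<Sum>w\<in>W. \<mu> w * V w y) = (\<Sum>w\<in>W. \<mu> w)"
      by (subst sum.swap) (use V1 in \<open>simp add: sum_distrib_left[symmetric]\<close>)
    thus ?thesis by (simp only: sum.distrib sum_distrib_left[symmetric])
  qed
  also have "(\<Sum>y\<in>?Y. neg_entropy W (\<lambda>w. \<mu> w * V w y)) \<le> neg_entropy W \<mu> + C * (\<Sum>w\<in>W. \<mu> w)"
    using W fin Suc.prems(1) V V1 bound by (intro neg_entropy_posteriors) auto
  finally show ?case by (simp add: algebra_simps)
qed

section \<open>From error probability to code size and rate\<close>

lemma error_prob_eq:
  assumes "M > 0"
  shows "error_prob N m M enc rel dec =
    (\<Sum>w<M. measure_pmf.prob (replicate_pmf m (noise N)) {zs. dec (dest_out N rel (enc w) m zs) \<noteq> w}) / M"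
proof -
  let ?Z = "replicate_pmf m (noise N)"
  have "error_prob N m M enc rel dec =
      measure_pmf.prob (bind_pmf (pmf_of_set {..<M}) (\<lambda>w. map_pmf (Pair w) ?Z))
        {(w, zs). dec (dest_out N rel (enc w) m zs) \<noteq> w}"
    unfolding error_prob_def
    by (simp add: pair_pmf_def map_pmf_def dest_out_def case_prod_beta)
  also have "\<dots> = measure_pmf.expectation (pmf_of_set {..<M})
      (\<lambda>w. measure_pmf.prob ?Z {zs. dec (dest_out N rel (enc w) m zs) \<noteq> w})"
    unfolding measure_bind_pmf by (simp add: vimage_def)
  also have "\<dots> = (\<Sum>w<M. measure_pmf.prob ?Z {zs. dec (dest_out N rel (enc w) m zs) \<noteq> w}) / M"
    using assms by (subst integral_pmf_of_set) auto
  finally show ?thesis .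
qed

text \<open>Fano's inequality, with the binary entropy replaced by a bound that is linear in the error
  probability.\<close>

lemma code_size_bound:
  fixes dec :: "'y3 list \<Rightarrow> nat" and N :: "('x1, 'x2, 'y2, 'y3, 'z) relay_ibm"
  assumes N: "relay_channel N" and deg: "reversely_degraded N"
    and C: "\<And>a P. a \<in> relay_codes N \<Longrightarrow> P \<in> input_pmfs N \<Longrightarrow>
      info_X1_Y3_given N (pair_pmf P (return_pmf a)) a \<le> C"
    and code: "valid_code N m M enc rel" and M: "M > 0" and \<delta>: "0 < \<delta>" "\<delta> < 1"
  defines "e \<equiv> error_prob N m M enc rel dec"
  shows "log 2 M * (1 - e) \<le> real m * C - log 2 (1 - \<delta>) - e * log 2 \<delta>"
proof -
  let ?L = "block_length N"
  let ?Z = "replicate_pmf m (noise N)"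
  \<comment> \<open>Weight \<open>1 - \<delta>\<close> goes to the decoded message and
    \<open>\<delta>\<close> is spread evenly, so that an error costs log (M / \<delta>) and not
    infinity. The total stays at most 1 even if \<open>dec y\<close> is no message.\<close>
  define q where "q y w = (if dec y = w then 1 - \<delta> else \<delta> / M)" for y :: "'y3 list" and w :: nat
  define err where "err w = measure_pmf.prob ?Z {zs. dec (dest_out N rel (enc w) m zs) \<noteq> w}" for w
  have q_pos: "q y w > 0" for y w using \<delta> M by (simp add: q_def)
  have q_sum: "(\<Sum>w<M. q y w) \<le> 1" for y
  proof -
    have "(\<Sum>w<M. q y w) \<le> (\<Sum>w<M. (if dec y = w then 1 - \<delta> else 0) + \<delta> / M)"
      using \<delta> by (intro sum_mono) (auto simp: q_def)
    also have "\<dots> \<le> 1" using \<delta> M by (simp add: sum.distrib)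
    finally show ?thesis .
  qed
  have score: "measure_pmf.expectation ?Z (\<lambda>zs. log 2 (q (dest_out N rel (enc w) m zs) w)) =
      log 2 (1 - \<delta>) + err w * (log 2 (\<delta> / M) - log 2 (1 - \<delta>))" for w
  proof -
    let ?E = "{zs. dec (dest_out N rel (enc w) m zs) \<noteq> w}"
    have int: "integrable ?Z (indicat_real ?E)"
      by (intro measure_pmf.integrable_const_bound[where B = 1]) auto
    have "measure_pmf.expectation ?Z (\<lambda>zs. log 2 (q (dest_out N rel (enc w) m zs) w)) =
        measure_pmf.expectation ?Z (\<lambda>zs. log 2 (1 - \<delta>) +
          indicator ?E zs * (log 2 (\<delta> / M) - log 2 (1 - \<delta>)))"
      by (intro Bochner_Integration.integral_cong refl) (auto simp: q_def indicator_def)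
    also have "\<dots> = log 2 (1 - \<delta>) + err w * (log 2 (\<delta> / M) - log 2 (1 - \<delta>))"
      using int by (subst Bochner_Integration.integral_add) (auto simp: err_def)
    finally show ?thesis .
  qed
  have e: "(\<Sum>w<M. err w) = e * M"
    using M by (simp add: e_def error_prob_eq err_def)
  have "e \<ge> 0" by (simp add: e_def error_prob_def)
  have "(\<Sum>w<M. 1 / M * measure_pmf.expectation ?Z (\<lambda>zs. log 2 (q (dest_out N rel (enc w) m zs) w)))
    \<le> neg_entropy {..<M} (\<lambda>_. 1 / M) + real m * C * (\<Sum>w<M. 1 / M)"
    using code by (intro score_le_neg_entropy N deg C q_pos q_sum) (auto simp: valid_code_def Let_def)
  also have "neg_entropy {..<M} (\<lambda>_. 1 / M) = - log 2 M"
    using M by (simp add: neg_entropy_def xlog_def log_divide)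
  also have "(\<Sum>w<M. 1 / M * measure_pmf.expectation ?Z (\<lambda>zs. log 2 (q (dest_out N rel (enc w) m zs) w))) =
      log 2 (1 - \<delta>) + e * (log 2 (\<delta> / M) - log 2 (1 - \<delta>))"
    unfolding score using M e
    by (simp add: sum.distrib sum_distrib_right[symmetric] sum_divide_distrib[symmetric] add_divide_distrib)
  finally have "log 2 (1 - \<delta>) + e * (log 2 (\<delta> / M) - log 2 (1 - \<delta>)) \<le> - log 2 M + real m * C"
    using M by simp
  moreover have "e * log 2 (1 - \<delta>) \<le> 0"
    using \<open>e \<ge> 0\<close> \<delta> by (intro mult_nonneg_nonpos) auto
  moreover have "log 2 (\<delta> / M) = log 2 \<delta> - log 2 M" using \<delta> M by (simp add: log_divide)
  ultimately show ?thesis by (simp add: algebra_simps)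
qed

text \<open>The order of the limits matters: \<open>e * log 2 \<delta>\<close> disappears only if
  the error bound \<open>e\<close> tends to 0 at fixed \<open>\<delta>\<close>; letting
  \<open>\<delta>\<close> tend to 0 afterwards removes \<open>log 2 (1 - \<delta>)\<close>.\<close>

lemma achievable_le:
  assumes N: "relay_channel N" and deg: "reversely_degraded N"
    and C: "\<And>a P. a \<in> relay_codes N \<Longrightarrow> P \<in> input_pmfs N \<Longrightarrow>
      info_X1_Y3_given N (pair_pmf P (return_pmf a)) a \<le> C"
    and R: "achievable N R"
  shows "R \<le> C / block_length N"
proof -
  let ?L = "real (block_length N)"
  have L: "?L \<ge> 1" using relay_channel_finite(1)[OF N] by simp
  have 1: "R * (1 - e) \<le> C / ?L - log 2 (1 - \<delta>) - e * log 2 \<delta>"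
    if \<delta>: "0 < \<delta>" "\<delta> < 1" and e: "0 < e" "e < 1" for \<delta> e
  proof -
    obtain m M enc rel dec where c: "m > 0" "real M = 2 powr (real (m * block_length N) * R)"
      "valid_code N m M enc rel" "error_prob N m M enc rel dec \<le> e"
      using R e by (auto simp: achievable_def)
    have "real M > 0" unfolding c(2) by simp
    hence M: "M > 0" by simp
    let ?e = "error_prob N m M enc rel dec"
    let ?n = "real m * ?L"
    have n: "?n \<ge> 1" using c(1) mult_mono[of 1 "real m" 1 ?L] L by simp
    have logM: "log 2 M = ?n * R" by (simp add: c(2))
    \<comment> \<open>At least one message exists, so the rate is nonnegative; only then does
      replacing the true error probability by the larger \<open>e\<close> lower the left-hand
      side.\<close>
    have "?n * R \<ge> 0" unfolding logM[symmetric] using M by simp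
    hence "R \<ge> 0" using n by (simp add: zero_le_mult_iff)
    have "?n * (R * (1 - e)) \<le> log 2 M * (1 - ?e)"
      unfolding logM using c(4) n \<open>R \<ge> 0\<close> by (simp add: mult_left_mono mult.assoc)
    also have "\<dots> \<le> real m * C - log 2 (1 - \<delta>) - ?e * log 2 \<delta>"
      by (rule code_size_bound[OF N deg C c(3) M \<delta>])
    also have "\<dots> \<le> real m * C - log 2 (1 - \<delta>) - e * log 2 \<delta>"
      using c(4) \<delta> by (simp add: mult_right_mono_neg)
    \<comment> \<open>The number of blocks supplied by \<open>achievable\<close> is not known to
      grow, so the penalty cannot be made small by dividing by n. It is enlarged by the factor n
      \<ge> 1 instead, and the limits dispose of it.\<close>
    also have "\<dots> \<le> ?n * (C / ?L) + ?n * (- log 2 (1 - \<delta>) - e * log 2 \<delta>)"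
    proof -
      have "e * log 2 \<delta> \<le> 0" using \<delta> e by (intro mult_nonneg_nonpos) auto
      moreover have "log 2 (1 - \<delta>) \<le> 0" using \<delta> by simp
      ultimately have "0 \<le> - log 2 (1 - \<delta>) - e * log 2 \<delta>" by simp
      from mult_right_mono[OF n this] show ?thesis using L by simp
    qed
    also have "\<dots> = ?n * (C / ?L - log 2 (1 - \<delta>) - e * log 2 \<delta>)" by (simp add: algebra_simps)
    finally show ?thesis using n by (subst (asm) mult_le_cancel_left_pos) auto
  qed
  have 2: "R \<le> C / ?L - log 2 (1 - \<delta>)" if \<delta>: "0 < \<delta>" "\<delta> < 1" for \<delta>
  proof (rule tendsto_le)
    show "((\<lambda>e. R * (1 - e)) \<longlongrightarrow> R) (at_right 0)"
      by (rule tendsto_eq_intros refl | simp)+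
    show "((\<lambda>e. C / ?L - log 2 (1 - \<delta>) - e * log 2 \<delta>) \<longlongrightarrow> C / ?L - log 2 (1 - \<delta>)) (at_right 0)"
      by (rule tendsto_eq_intros refl | simp)+
    show "eventually (\<lambda>e. R * (1 - e) \<le> C / ?L - log 2 (1 - \<delta>) - e * log 2 \<delta>) (at_right 0)"
      unfolding eventually_at_right_field using 1[OF \<delta>] by (intro exI[of _ 1]) auto
  qed auto
  show ?thesis
  proof (rule tendsto_le)
    show "((\<lambda>\<delta>. C / ?L - log 2 (1 - \<delta>)) \<longlongrightarrow> C / ?L) (at_right (0::real))"
      by (rule tendsto_eq_intros refl | simp)+
    show "eventually (\<lambda>\<delta>. R \<le> C / ?L - log 2 (1 - \<delta>)) (at_right (0::real))"
      unfolding eventually_at_right_field using 2 by (intro exI[of _ 1]) auto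
  qed (auto intro: tendsto_const)
qed

section \<open>Channel coding\<close>

text \<open>A codeword \<open>x\<close> can be added to a code with decoding sets \<open>B\<close> as long as \<open>D x - \<Union>B\<close> is likely
  given \<open>x\<close>; averaging over \<open>p\<close> shows that such an \<open>x\<close> exists while \<open>\<Union>B\<close> has small output
  probability.\<close>

lemma feinstein:
  fixes p :: "'x pmf" and V :: "'x \<Rightarrow> 'y pmf"
  assumes fin: "finite (set_pmf p)" and "\<beta> > 0"
    and D: "\<And>x. x \<in> set_pmf p \<Longrightarrow> measure_pmf.prob (bind_pmf p V) (D x) \<le> 1 / \<beta>"
    and avg: "measure_pmf.expectation p (\<lambda>x. measure_pmf.prob (V x) (D x)) \<ge> 1 - \<eta>"
    and "real k \<le> \<beta> * \<eta>'"
  shows "\<exists>c B. (\<forall>w<k. c w \<in> set_pmf p \<and> measure_pmf.prob (V (c w)) (B w) \<ge> 1 - \<eta> - \<eta>') \<and>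
    disjoint_family_on B {..<k} \<and> measure_pmf.prob (bind_pmf p V) (\<Union>w<k. B w) \<le> k / \<beta>"
  using assms(5)
proof (induction k)
  case 0
  show ?case by (simp add: disjoint_family_on_def)
next
  case (Suc k)
  let ?Q = "bind_pmf p V"
  obtain c B where cB: "\<And>w. w < k \<Longrightarrow> c w \<in> set_pmf p"
      "\<And>w. w < k \<Longrightarrow> measure_pmf.prob (V (c w)) (B w) \<ge> 1 - \<eta> - \<eta>'"
      "disjoint_family_on B {..<k}" "measure_pmf.prob ?Q (\<Union>w<k. B w) \<le> k / \<beta>"
    using Suc by auto
  define U where "U = (\<Union>w<k. B w)"
  \<comment> \<open>Room for \<open>Suc k\<close> codewords makes this strict for \<open>k\<close>,
    and the contradiction below rests on the strictness.\<close>
  have "real k / \<beta> < \<eta>'"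
    using Suc.prems \<open>\<beta> > 0\<close> by (simp add: field_simps)
  hence U: "measure_pmf.prob ?Q U < \<eta>'" using cB(4) by (simp add: U_def)
  have "\<exists>x\<in>set_pmf p. measure_pmf.prob (V x) (D x - U) \<ge> 1 - \<eta> - \<eta>'"
  proof (rule ccontr)
    assume neg: "\<not> ?thesis"
    have "1 - \<eta> \<le> measure_pmf.expectation p (\<lambda>x. measure_pmf.prob (V x) (D x))" by (rule avg)
    also have "\<dots> \<le> measure_pmf.expectation p (\<lambda>x. (1 - \<eta> - \<eta>') + measure_pmf.prob (V x) U)"
    proof (rule expectation_mono_on[OF fin])
      fix x assume "x \<in> set_pmf p"
      hence "measure_pmf.prob (V x) (D x - U) \<le> 1 - \<eta> - \<eta>'" using neg by force
      moreover have "measure_pmf.prob (V x) (D x) \<le> measure_pmf.prob (V x) ((D x - U) \<union> U)"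
        by (intro measure_pmf.finite_measure_mono) auto
      moreover have "\<dots> \<le> measure_pmf.prob (V x) (D x - U) + measure_pmf.prob (V x) U"
        by (intro measure_Un_le) auto
      ultimately show "measure_pmf.prob (V x) (D x) \<le> (1 - \<eta> - \<eta>') + measure_pmf.prob (V x) U"
        by simp
    qed
    also have "\<dots> = (1 - \<eta> - \<eta>') + measure_pmf.prob ?Q U"
      using fin by (simp add: measure_bind_pmf integrable_measure_pmf_finite)
    finally show False using U by simp
  qed
  then obtain x where x: "x \<in> set_pmf p" "measure_pmf.prob (V x) (D x - U) \<ge> 1 - \<eta> - \<eta>'"
    by blast
  define B' where "B' = B(k := D x - U)"
  have eq: "(\<Union>w<Suc k. B' w) = U \<union> (D x - U)"
    by (auto simp: B'_def U_def less_Suc_eq split: if_splits)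
  have "measure_pmf.prob ?Q (U \<union> (D x - U)) \<le> measure_pmf.prob ?Q U + measure_pmf.prob ?Q (D x - U)"
    by (intro measure_Un_le) auto
  also have "measure_pmf.prob ?Q (D x - U) \<le> measure_pmf.prob ?Q (D x)"
    by (intro measure_pmf.finite_measure_mono) auto
  also have "\<dots> \<le> 1 / \<beta>" by (rule D[OF x(1)])
  also have "measure_pmf.prob ?Q U \<le> k / \<beta>" using cB(4) by (simp add: U_def)
  finally have "measure_pmf.prob ?Q (\<Union>w<Suc k. B' w) \<le> real (Suc k) / \<beta>"
    unfolding eq by (simp add: add_divide_distrib)
  moreover have "disjoint_family_on B' {..<Suc k}"
    using cB(3) by (fastforce simp: disjoint_family_on_def B'_def U_def less_Suc_eq)
  moreover have "\<forall>w<Suc k. (c(k := x)) w \<in> set_pmf p \<and>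
      measure_pmf.prob (V ((c(k := x)) w)) (B' w) \<ge> 1 - \<eta> - \<eta>'"
    using cB(1,2) x by (auto simp: B'_def less_Suc_eq)
  ultimately show ?case by blast
qed

section \<open>Weak law of large numbers for independent samples\<close>

lemma replicate_pmf_variance:
  fixes g :: "'a \<Rightarrow> real"
  assumes fin: "finite (set_pmf p)" and mean: "measure_pmf.expectation p g = 0"
  shows "measure_pmf.expectation (replicate_pmf m p) (\<lambda>l. sum_list (map g l)) = 0"
    and "measure_pmf.expectation (replicate_pmf m p) (\<lambda>l. (sum_list (map g l))\<^sup>2) =
      m * measure_pmf.expectation p (\<lambda>x. (g x)\<^sup>2)"
proof -
  note int = integrable_measure_pmf_finite[OF finite_replicate_pmf[OF fin]]
    integrable_measure_pmf_finite[OF fin]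
  have 1: "measure_pmf.expectation (replicate_pmf m p) (\<lambda>l. sum_list (map g l)) = 0" for m
  proof (induction m)
    case (Suc m)
    thus ?case using mean
      by (simp add: expectation_replicate_Suc[OF fin] int del: replicate_pmf.simps)
  qed simp
  show "measure_pmf.expectation (replicate_pmf m p) (\<lambda>l. sum_list (map g l)) = 0" by (rule 1)
  show "measure_pmf.expectation (replicate_pmf m p) (\<lambda>l. (sum_list (map g l))\<^sup>2) =
      m * measure_pmf.expectation p (\<lambda>x. (g x)\<^sup>2)"
  proof (induction m)
    case (Suc m)
    have "measure_pmf.expectation (replicate_pmf m p) (\<lambda>l. (sum_list (map g (z # l)))\<^sup>2) =
        (g z)\<^sup>2 + m * measure_pmf.expectation p (\<lambda>x. (g x)\<^sup>2)" for z
    proof -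
      have "measure_pmf.expectation (replicate_pmf m p) (\<lambda>l. (sum_list (map g (z # l)))\<^sup>2) =
        measure_pmf.expectation (replicate_pmf m p)
          (\<lambda>l. (g z)\<^sup>2 + 2 * g z * sum_list (map g l) + (sum_list (map g l))\<^sup>2)"
        by (simp add: power2_sum algebra_simps)
      \<comment> \<open>The mixed term drops out because the rest of the sum has mean 0.\<close>
      thus ?thesis using Suc by (simp add: int 1)
    qed
    thus ?case
      by (simp add: expectation_replicate_Suc[OF fin] int algebra_simps del: replicate_pmf.simps)
  qed simp
qed

lemma replicate_pmf_chebyshev:
  fixes g :: "'a \<Rightarrow> real"
  assumes fin: "finite (set_pmf p)" and "t > 0" "m > 0"
  defines "\<mu> \<equiv> measure_pmf.expectation p g"
  shows "measure_pmf.prob (replicate_pmf m p) {l. sum_list (map g l) < m * (\<mu> - t)} \<le>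
    measure_pmf.expectation p (\<lambda>x. (g x - \<mu>)\<^sup>2) / (m * t\<^sup>2)"
proof -
  let ?R = "replicate_pmf m p"
  let ?S = "\<lambda>l. sum_list (map (\<lambda>x. g x - \<mu>) l)"
  let ?E = "{l. sum_list (map g l) < m * (\<mu> - t)}"
  have "measure_pmf.prob ?R ?E = measure_pmf.expectation ?R (indicator ?E)" by simp
  also have "\<dots> \<le> measure_pmf.expectation ?R (\<lambda>l. (?S l)\<^sup>2 / (m * t)\<^sup>2)"
  proof (rule expectation_mono_on[OF finite_replicate_pmf[OF fin]])
    fix l assume "l \<in> set_pmf ?R"
    hence l: "length l = m" by (simp add: set_replicate_pmf)
    have S: "?S l = sum_list (map g l) - m * \<mu>"
      by (simp add: sum_list_subtractf l sum_list_triv)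
    show "indicator ?E l \<le> (?S l)\<^sup>2 / (m * t)\<^sup>2"
    proof (cases "l \<in> ?E")
      case True
      hence "m * t \<le> \<bar>?S l\<bar>" using S by (simp add: algebra_simps)
      hence "(m * t)\<^sup>2 \<le> (?S l)\<^sup>2" using assms(2) power_mono[of "m * t" "\<bar>?S l\<bar>" 2] by simp
      thus ?thesis using True assms(2,3) by simp
    qed simp
  qed
  also have "\<dots> = (m * measure_pmf.expectation p (\<lambda>x. (g x - \<mu>)\<^sup>2)) / (m * t)\<^sup>2"
    using replicate_pmf_variance(2)[OF fin, of "\<lambda>x. g x - \<mu>" m] fin
    by (simp add: \<mu>_def integrable_measure_pmf_finite)
  also have "\<dots> = measure_pmf.expectation p (\<lambda>x. (g x - \<mu>)\<^sup>2) / (m * t\<^sup>2)"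
    using assms(3) by (simp add: power2_eq_square)
  finally show ?thesis .
qed

section \<open>Memoryless extension of a channel\<close>

primrec product_kernel :: "('x \<Rightarrow> 'y pmf) \<Rightarrow> 'x list \<Rightarrow> 'y list pmf" where
  "product_kernel K [] = return_pmf []"
| "product_kernel K (x # xs) = bind_pmf (K x) (\<lambda>y. map_pmf ((#) y) (product_kernel K xs))"

lemma set_product_kernel:
  "ys \<in> set_pmf (product_kernel K xs) \<Longrightarrow> list_all2 (\<lambda>x y. y \<in> set_pmf (K x)) xs ys"
  by (induction xs arbitrary: ys) auto

lemma replicate_pmf_Suc': "replicate_pmf (Suc m) p = bind_pmf p (\<lambda>z. map_pmf ((#) z) (replicate_pmf m p))"
  by (simp add: map_pmf_def)

lemma map_replicate_pmf: "map_pmf (map f) (replicate_pmf m p) = replicate_pmf m (map_pmf f p)"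
proof (induction m)
  case (Suc m)
  show ?case
    unfolding replicate_pmf_Suc' Suc[symmetric]
    by (simp add: map_bind_pmf bind_map_pmf pmf.map_comp o_def)
qed simp

text \<open>Makes the weak law applicable: input-output pairs are again i.i.d., so the
  log-likelihood ratio of a whole word is a sum of independent terms.\<close>

lemma replicate_joint:
  "bind_pmf (replicate_pmf m p) (\<lambda>xs. map_pmf (Pair xs) (product_kernel K xs)) =
    map_pmf (\<lambda>l. (map fst l, map snd l)) (replicate_pmf m (bind_pmf p (\<lambda>x. map_pmf (Pair x) (K x))))"
proof (induction m)
  case 0
  show ?case by (simp add: bind_return_pmf)
next
  case (Suc m)
  let ?J = "bind_pmf p (\<lambda>x. map_pmf (Pair x) (K x))"
  have "bind_pmf (replicate_pmf (Suc m) p) (\<lambda>xs. map_pmf (Pair xs) (product_kernel K xs)) =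
    bind_pmf p (\<lambda>x. bind_pmf (replicate_pmf m p) (\<lambda>xs. bind_pmf (K x) (\<lambda>y.
      map_pmf (\<lambda>ys. (x # xs, y # ys)) (product_kernel K xs))))"
    unfolding replicate_pmf_Suc'
    by (simp add: map_bind_pmf bind_map_pmf bind_assoc_pmf pmf.map_comp o_def)
  \<comment> \<open>The first output and the remaining inputs are independent given the first input,
    so the two draws can be exchanged.\<close>
  also have "\<dots> = bind_pmf p (\<lambda>x. bind_pmf (K x) (\<lambda>y. map_pmf (\<lambda>(xs, ys). (x # xs, y # ys))
      (bind_pmf (replicate_pmf m p) (\<lambda>xs. map_pmf (Pair xs) (product_kernel K xs)))))"
    by (subst bind_commute_pmf) (simp add: map_bind_pmf pmf.map_comp o_def)
  also have "\<dots> = map_pmf (\<lambda>l. (map fst l, map snd l)) (replicate_pmf (Suc m) ?J)"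
    unfolding Suc replicate_pmf_Suc'
    by (simp add: map_bind_pmf bind_map_pmf bind_assoc_pmf pmf.map_comp o_def)
  finally show ?case .
qed

lemma bind_product_kernel:
  "bind_pmf (replicate_pmf m p) (product_kernel K) = replicate_pmf m (bind_pmf p K)"
proof -
  have "bind_pmf (replicate_pmf m p) (product_kernel K) =
    map_pmf snd (bind_pmf (replicate_pmf m p) (\<lambda>xs. map_pmf (Pair xs) (product_kernel K xs)))"
    by (simp add: map_bind_pmf pmf.map_comp o_def)
  also have "\<dots> = map_pmf (map snd) (replicate_pmf m (bind_pmf p (\<lambda>x. map_pmf (Pair x) (K x))))"
    unfolding replicate_joint by (simp add: pmf.map_comp o_def)
  also have "\<dots> = replicate_pmf m (bind_pmf p K)"
    by (simp add: map_replicate_pmf map_bind_pmf pmf.map_comp o_def)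
  finally show ?thesis .
qed

text \<open>Change of measure: under \<open>Q\<close> the ratio for one letter \<open>x\<close> has
  as its mean the \<open>K x\<close>-probability of the support of \<open>Q\<close>, which can be
  below 1 because \<open>x\<close> is arbitrary. Through Markov's inequality this bounds the output
  probability of a decoding set.\<close>

lemma likelihood_ratio_product:
  assumes "finite (set_pmf Q)"
  shows "measure_pmf.expectation (replicate_pmf (length xs) Q)
    (\<lambda>ys. prod_list (map2 (\<lambda>x y. pmf (K x) y / pmf Q y) xs ys)) \<le> 1"
proof (induction xs)
  case (Cons x xs)
  let ?R = "replicate_pmf (length xs) Q"
  let ?h = "\<lambda>x y. pmf (K x) y / pmf Q y"
  have "measure_pmf.expectation Q (?h x) = (\<Sum>y\<in>set_pmf Q. pmf Q y * ?h x y)"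
    using assms by (subst integral_measure_pmf[of "set_pmf Q"]) auto
  also have "\<dots> = (\<Sum>y\<in>set_pmf Q. pmf (K x) y)"
    by (intro sum.cong) (auto simp: set_pmf_iff)
  also have "\<dots> = measure_pmf.prob (K x) (set_pmf Q)"
    using assms by (simp add: measure_measure_pmf_finite)
  also have "\<dots> \<le> 1" by simp
  finally have 1: "measure_pmf.expectation Q (?h x) \<le> 1" .
  have "measure_pmf.expectation (replicate_pmf (length (x # xs)) Q) (\<lambda>ys. prod_list (map2 ?h (x # xs) ys)) =
    measure_pmf.expectation Q (?h x) * measure_pmf.expectation ?R (\<lambda>ys. prod_list (map2 ?h xs ys))"
    by (simp add: expectation_replicate_Suc[OF assms] del: replicate_pmf.simps times_divide_eq_left)
  also have "\<dots> \<le> 1 * 1"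
    using 1 Cons by (intro mult_mono) (auto intro!: integral_nonneg_AE AE_I2 prod_list_nonneg simp: in_set_zip)
  finally show ?case by simp
qed simp

text \<open>The candidate decoding set of a word consists of the outputs with likelihood ratio at
  least \<open>\<beta>\<close>. Change of measure makes it unlikely under the output law, the weak
  law makes it likely on average under the transmitted word, and these are the two hypotheses of
  \<open>feinstein\<close>.\<close>

lemma channel_coding:
  fixes p :: "'x pmf" and K :: "'x \<Rightarrow> 'y pmf"
  assumes finp: "finite (set_pmf p)" and finK: "\<And>x. x \<in> set_pmf p \<Longrightarrow> finite (set_pmf (K x))"
  defines "J \<equiv> bind_pmf p (\<lambda>x. map_pmf (Pair x) (K x))"
  defines "I \<equiv> measure_pmf.expectation J (\<lambda>(x, y). log 2 (pmf (K x) y / pmf (bind_pmf p K) y))"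
  assumes "\<rho> < I" "\<epsilon> > 0"
  obtains m0 where "\<And>m M. m \<ge> m0 \<Longrightarrow> real M \<le> 2 powr (m * \<rho>) \<Longrightarrow>
    \<exists>c B. (\<forall>w<M. c w \<in> set_pmf (replicate_pmf m p) \<and>
        measure_pmf.prob (product_kernel K (c w)) (B w) \<ge> 1 - \<epsilon>) \<and> disjoint_family_on B {..<M}"
proof -
  define Q where "Q = bind_pmf p K"
  define h where "h x y = pmf (K x) y / pmf Q y" for x y
  define g where "g = (\<lambda>(x, y). log 2 (h x y))"
  have finJ: "finite (set_pmf J)" and finQ: "finite (set_pmf Q)"
    using finp finK by (auto simp: J_def Q_def)
  have I: "I = measure_pmf.expectation J g" by (simp add: I_def g_def h_def Q_def)
  \<comment> \<open>Half of the gap: one half absorbs the deviation in the weak law, the other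
    leaves the vanishing factor \<open>(2 powr - \<delta>) ^ m\<close> between the number of
    messages and the threshold \<open>\<beta>\<close>.\<close>
  define \<delta> where "\<delta> = (I - \<rho>) / 2"
  have \<delta>: "\<delta> > 0" using assms(5) by (simp add: \<delta>_def)
  define v where "v = measure_pmf.expectation J (\<lambda>x. (g x - I)\<^sup>2)"
  have "(\<lambda>m. v / \<delta>\<^sup>2 / real m) \<longlonglongrightarrow> 0"
    by (rule real_tendsto_divide_at_top[OF tendsto_const filterlim_real_sequentially])
  hence ev1: "eventually (\<lambda>m. v / \<delta>\<^sup>2 / real m < \<epsilon> / 2) sequentially"
    using \<open>\<epsilon> > 0\<close> by (intro order_tendstoD) auto
  have "(\<lambda>m. (2 powr - \<delta>) ^ m) \<longlonglongrightarrow> 0"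
    using \<delta> powr_less_mono[of "- \<delta>" 0 2] by (intro LIMSEQ_power_zero) auto
  hence ev2: "eventually (\<lambda>m. (2 powr - \<delta>) ^ m < \<epsilon> / 2) sequentially"
    using \<open>\<epsilon> > 0\<close> by (intro order_tendstoD) auto
  from eventually_conj[OF eventually_gt_at_top[of 0] eventually_conj[OF ev1 ev2]]
  obtain m0 where m0: "\<And>m. m \<ge> m0 \<Longrightarrow> m > 0 \<and> v / \<delta>\<^sup>2 / real m < \<epsilon> / 2 \<and> (2 powr - \<delta>) ^ m < \<epsilon> / 2"
    by (auto simp: eventually_sequentially)
  show ?thesis
  proof (rule that)
    fix m M assume m: "m \<ge> m0" and M: "real M \<le> 2 powr (m * \<rho>)"
    let ?p = "replicate_pmf m p" and ?V = "product_kernel K"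
    define \<beta> where "\<beta> = 2 powr (m * (I - \<delta>))"
    define D where "D xs = {ys. prod_list (map2 h xs ys) \<ge> \<beta>}" for xs
    have "\<beta> > 0" by (simp add: \<beta>_def)
    have "measure_pmf.prob (bind_pmf ?p ?V) (D xs) \<le> 1 / \<beta>" if "xs \<in> set_pmf ?p" for xs
    proof -
      let ?R = "replicate_pmf (length xs) Q"
      have "length xs = m" using that by (simp add: set_replicate_pmf)
      hence "measure_pmf.prob (bind_pmf ?p ?V) (D xs) = measure_pmf.expectation ?R (indicator (D xs))"
        by (simp add: bind_product_kernel Q_def)
      also have "\<dots> \<le> measure_pmf.expectation ?R (\<lambda>ys. prod_list (map2 h xs ys) / \<beta>)"
      proof (rule expectation_mono_on[OF finite_replicate_pmf[OF finQ]])
        fix ys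
        have "prod_list (map2 h xs ys) \<ge> 0"
          by (intro prod_list_nonneg) (auto simp: h_def)
        thus "indicator (D xs) ys \<le> prod_list (map2 h xs ys) / \<beta>"
          using \<open>\<beta> > 0\<close> by (auto simp: indicator_def D_def)
      qed
      also have "\<dots> = measure_pmf.expectation ?R (\<lambda>ys. prod_list (map2 h xs ys)) / \<beta>" by simp
      also have "\<dots> \<le> 1 / \<beta>"
        using likelihood_ratio_product[OF finQ, of xs K] \<open>\<beta> > 0\<close>
        by (intro divide_right_mono) (auto simp: h_def)
      finally show ?thesis .
    qed
    moreover have "1 - \<epsilon> / 2 \<le> measure_pmf.expectation ?p (\<lambda>xs. measure_pmf.prob (?V xs) (D xs))"
    proof -
      let ?R = "replicate_pmf m J"
      let ?E = "{l. sum_list (map g l) < m * (I - \<delta>)}"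
      let ?T = "{(xs, ys). ys \<in> D xs}"
      have "measure_pmf.expectation ?p (\<lambda>xs. measure_pmf.prob (?V xs) (D xs)) =
          measure_pmf.prob (bind_pmf ?p (\<lambda>xs. map_pmf (Pair xs) (?V xs))) ?T"
        unfolding measure_bind_pmf by (simp add: vimage_def)
      also have "\<dots> = measure_pmf.prob ?R {l. map snd l \<in> D (map fst l)}"
        unfolding replicate_joint J_def[symmetric] by (simp add: vimage_def)
      finally have prob: "measure_pmf.expectation ?p (\<lambda>xs. measure_pmf.prob (?V xs) (D xs)) =
        measure_pmf.prob ?R {l. map snd l \<in> D (map fst l)}" .
      have "measure_pmf.prob ?R (- ?E) \<le> measure_pmf.prob ?R {l. map snd l \<in> D (map fst l)}"
      proof (rule measure_pmf.finite_measure_mono_AE)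
        have "map snd l \<in> D (map fst l)" if l: "l \<in> set_pmf ?R" "l \<notin> ?E" for l
        proof -
          \<comment> \<open>Pairs that can occur have positive ratio, so no logarithm takes its
            default value and the product of the ratios is 2 to the power of the sum.\<close>
          have h: "case_prod h z > 0" if "z \<in> set l" for z
          proof -
            have "z \<in> set_pmf J" using that l(1) by (auto simp: set_replicate_pmf)
            hence "fst z \<in> set_pmf p" "snd z \<in> set_pmf (K (fst z))" by (auto simp: J_def)
            moreover from this have "snd z \<in> set_pmf Q" by (auto simp: Q_def)
            ultimately show ?thesis by (simp add: h_def case_prod_beta pmf_positive)
          qed
          have "prod_list (map (case_prod h) l) = 2 powr sum_list (map g l)"
            using h
          proof (induction l)
            case (Cons z l)
            hence "case_prod h z > 0" by simp
            hence "case_prod h z = 2 powr g z" by (cases z) (auto simp: g_def)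
            thus ?case using Cons by (simp add: powr_add)
          qed simp
          moreover have "2 powr sum_list (map g l) \<ge> \<beta>" using l(2) by (simp add: \<beta>_def)
          ultimately show ?thesis by (simp add: D_def zip_map_fst_snd)
        qed
        thus "AE l in ?R. l \<in> - ?E \<longrightarrow> l \<in> {l. map snd l \<in> D (map fst l)}"
          by (auto simp: AE_measure_pmf_iff)
      qed simp
      moreover have "measure_pmf.prob ?R (- ?E) = 1 - measure_pmf.prob ?R ?E"
        using measure_pmf.prob_compl[of ?E ?R] by (simp add: Compl_eq_Diff_UNIV)
      moreover have "measure_pmf.prob ?R ?E \<le> v / (m * \<delta>\<^sup>2)"
        using replicate_pmf_chebyshev[OF finJ \<delta>, of m g] m0[OF m] by (simp add: I v_def)
      moreover have "v / (m * \<delta>\<^sup>2) \<le> \<epsilon> / 2" using m0[OF m] by (simp add: mult.commute)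
      ultimately show ?thesis unfolding prob by linarith
    qed
    moreover have "real M \<le> \<beta> * (\<epsilon> / 2)"
    proof -
      have "m * \<rho> = m * (I - \<delta>) + m * (- \<delta>)"
        by (simp add: \<delta>_def field_simps)
      hence "2 powr (m * \<rho>) = \<beta> * (2 powr - \<delta>) ^ m"
        by (simp only: powr_add \<beta>_def) (simp add: powr_realpow[symmetric] powr_powr mult.commute)
      also have "\<dots> \<le> \<beta> * (\<epsilon> / 2)" using m0[OF m] \<open>\<beta> > 0\<close> by (intro mult_left_mono) auto
      finally show ?thesis using M by simp
    qed
    \<comment> \<open>One half of \<open>\<epsilon>\<close> pays for atypical outputs, the other for
      outputs claimed by earlier codewords.\<close>
    ultimately have "\<exists>c B. (\<forall>w<M. c w \<in> set_pmf ?p \<and>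
        measure_pmf.prob (?V (c w)) (B w) \<ge> 1 - \<epsilon> / 2 - \<epsilon> / 2) \<and>
      disjoint_family_on B {..<M} \<and> measure_pmf.prob (bind_pmf ?p ?V) (\<Union>w<M. B w) \<le> M / \<beta>"
      by (intro feinstein finite_replicate_pmf finp \<open>\<beta> > 0\<close>)
    thus "\<exists>c B. (\<forall>w<M. c w \<in> set_pmf ?p \<and>
        measure_pmf.prob (?V (c w)) (B w) \<ge> 1 - \<epsilon>) \<and> disjoint_family_on B {..<M}"
      by auto
  qed
qed

section \<open>Achievability and capacity\<close>

definition periodic_relay :: "('x1, 'x2, 'y2, 'y3, 'z) relay_ibm \<Rightarrow> (nat \<Rightarrow> 'y2 list \<Rightarrow> 'x2) \<Rightarrow>
    nat \<Rightarrow> 'y2 list \<Rightarrow> 'x2" where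
  "periodic_relay N a t ys = a (t mod block_length N) (drop (t div block_length N * block_length N) ys)"

lemma block_out_periodic_relay: "block_out N (periodic_relay N a) x z = block_out N a x z"
proof -
  have "transmit N x (periodic_relay N a) [z] k = transmit N x a [z] k" if "k \<le> block_length N" for k
    using that by (induction k) (auto simp: periodic_relay_def Let_def)
  thus ?thesis by (simp add: block_out_def)
qed

lemma length_block_out: "block_out N a x z = (y2, y3) \<Longrightarrow> length y2 = block_length N \<and> length y3 = block_length N"
  using transmit_length[of N x a "[z]" "block_length N"]
  by (cases "transmit N x a [z] (block_length N)") (auto simp: block_out_def)

text \<open>A relay that ignores earlier blocks is unchanged by the shift of one block with relay
  outputs put in front; with independent noise this leaves independent copies of
  \<open>dest_kernel N a\<close>.\<close>

lemma dest_out_periodic_relay: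
  assumes L: "block_length N > 0" and "\<And>x. x \<in> set xs \<Longrightarrow> length x = block_length N"
  shows "map_pmf (dest_out N (periodic_relay N a) (concat xs) (length xs)) (replicate_pmf (length xs) (noise N)) =
    map_pmf concat (product_kernel (dest_kernel N a) xs)"
  using assms(2)
proof (induction xs)
  case Nil
  show ?case by (simp add: dest_out_def)
next
  case (Cons x xs)
  let ?L = "block_length N" and ?r = "periodic_relay N a"
  let ?R = "replicate_pmf (length xs) (noise N)"
  have x: "length x = ?L" using Cons.prems by simp
  have step: "dest_out N ?r (concat (x # xs)) (Suc (length xs)) (z # zs) =
      snd (block_out N a x z) @ dest_out N ?r (concat xs) (length xs) zs" for z zs
  proof -
    obtain y2 y3 where b: "block_out N a x z = (y2, y3)" by (metis surj_pair)
    have "(\<lambda>i ys. ?r (?L + i) (y2 @ ys)) = ?r"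
      using length_block_out[OF b] L by (intro ext) (simp add: periodic_relay_def)
    moreover have "block_out N ?r (take ?L (concat (x # xs))) z = (y2, y3)"
      by (simp add: block_out_periodic_relay x b)
    ultimately show ?thesis
      using dest_out_Suc[OF L, of ?r "concat (x # xs)" z y2 y3 "length xs" zs] x b by simp
  qed
  have "map_pmf (dest_out N ?r (concat (x # xs)) (length (x # xs))) (replicate_pmf (length (x # xs)) (noise N)) =
    bind_pmf (noise N) (\<lambda>z. map_pmf ((@) (snd (block_out N a x z)))
      (map_pmf (dest_out N ?r (concat xs) (length xs)) ?R))"
    unfolding length_Cons replicate_pmf_Suc' map_bind_pmf pmf.map_comp
    by (simp only: o_def step)
  also have "\<dots> = bind_pmf (noise N) (\<lambda>z. map_pmf ((@) (snd (block_out N a x z)))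
      (map_pmf concat (product_kernel (dest_kernel N a) xs)))"
    using Cons by simp
  also have "\<dots> = map_pmf concat (product_kernel (dest_kernel N a) (x # xs))"
    by (simp add: dest_kernel_def[of N a x] block_kernel_def map_bind_pmf bind_map_pmf pmf.map_comp o_def)
  finally show ?case .
qed

lemma concat_in_seqs:
  assumes "L > 0" "\<And>x. x \<in> set xs \<Longrightarrow> x \<in> seqs A L"
  shows "concat xs \<in> seqs (\<lambda>t. A (t mod L)) (length xs * L)"
  using assms(2)
proof (induction xs)
  case (Cons x xs)
  have "length x = L" "\<And>i. i < L \<Longrightarrow> x ! i \<in> A i"
    "length (concat xs) = length xs * L" "\<And>i. i < length xs * L \<Longrightarrow> concat xs ! i \<in> A (i mod L)"
    using Cons by (auto simp: seqs_def)
  thus ?case by (auto simp: seqs_def nth_append le_mod_geq)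
qed (simp add: seqs_def)

lemma valid_block_code:
  assumes N: "relay_channel N" and a: "a \<in> relay_codes N"
    and c: "\<And>w. w < M \<Longrightarrow> length (c w) = m \<and> set (c w) \<subseteq> seqs (alph_X1 N) (block_length N)"
  shows "valid_code N m M (\<lambda>w. concat (c w)) (periodic_relay N a)"
proof -
  let ?L = "block_length N"
  note L = relay_channel_finite(1)[OF N]
  have "concat (c w) \<in> seqs (\<lambda>t. alph_X1 N (t mod ?L)) (m * ?L)" if "w < M" for w
    using concat_in_seqs[OF L, of "c w" "alph_X1 N"] c[OF that] by auto
  moreover have "periodic_relay N a t ys \<in> alph_X2 N (t mod ?L)"
    if "ys \<in> seqs (\<lambda>t. alph_Y2 N (t mod ?L)) t" for t ys
  proof -
    have t: "t mod ?L < ?L" "t - t div ?L * ?L = t mod ?L"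
      using L by (auto simp: minus_div_mult_eq_mod)
    have "drop (t div ?L * ?L) ys \<in> seqs (\<lambda>i. alph_Y2 N ((t div ?L * ?L + i) mod ?L)) (t mod ?L)"
      using seqs_drop[OF that, of "t div ?L * ?L"] t(2) by simp
    also have "\<dots> = seqs (alph_Y2 N) (t mod ?L)"
      using t(1) by (intro seqs_cong) auto
    finally show ?thesis
      using a t(1) by (auto simp: periodic_relay_def relay_codes_def PiE_iff)
  qed
  ultimately show ?thesis by (simp add: valid_code_def Let_def)
qed

text \<open>A single message is always decoded. This makes the set of rates nonempty and every upper
  bound of it nonnegative.\<close>

lemma achievable_0:
  assumes N: "relay_channel N"
  shows "achievable N 0"
proof -
  obtain a where a: "a \<in> relay_codes N" using relay_channel_finite(8)[OF N] by auto
  obtain x where x: "x \<in> seqs (alph_X1 N) (block_length N)" using relay_channel_finite(4)[OF N] by auto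
  have "valid_code N 1 1 (\<lambda>w. concat [x]) (periodic_relay N a)"
    using x by (intro valid_block_code[OF N a]) auto
  moreover have "error_prob N 1 1 (\<lambda>w. concat [x]) (periodic_relay N a) (\<lambda>_. 0) = 0"
    by (subst error_prob_eq) auto
  ultimately have "real 1 = 2 powr (real (1 * block_length N) * 0) \<and>
      valid_code N 1 1 (\<lambda>w. concat [x]) (periodic_relay N a) \<and>
      error_prob N 1 1 (\<lambda>w. concat [x]) (periodic_relay N a) (\<lambda>_. 0) \<le> \<epsilon>" if "\<epsilon> > 0" for \<epsilon>
    using that by simp
  thus ?thesis unfolding achievable_def using zero_less_one by blast
qed

text \<open>Puts the information of the statement into the form of the rate threshold in
  \<open>channel_coding\<close>.\<close>

lemma info_eq_expectation:
  assumes N: "relay_channel N" and P: "P \<in> input_pmfs N" and a: "a \<in> relay_codes N"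
  shows "info_X1_Y3_given N (pair_pmf P (return_pmf a)) a =
    measure_pmf.expectation (bind_pmf P (\<lambda>x. map_pmf (Pair x) (dest_kernel N a x)))
      (\<lambda>(x, y). log 2 (pmf (dest_kernel N a x) y / pmf (bind_pmf P (dest_kernel N a)) y))"
proof -
  let ?A = "seqs (alph_X1 N) (block_length N)" and ?B = "seqs (alph_Y3 N) (block_length N)"
  let ?K = "dest_kernel N a"
  note fin = relay_channel_finite[OF N]
  have P': "set_pmf P \<subseteq> ?A" using P by (simp add: input_pmfs_def)
  have K: "set_pmf (?K x) \<subseteq> ?B" if "x \<in> ?A" for x
    using block_out_in[OF N that a] by (force simp: dest_kernel_def block_kernel_def)
  have "measure_pmf.expectation (bind_pmf P (\<lambda>x. map_pmf (Pair x) (?K x)))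
      (\<lambda>(x, y). log 2 (pmf (?K x) y / pmf (bind_pmf P ?K) y)) =
    measure_pmf.expectation P (\<lambda>x. measure_pmf.expectation (?K x)
      (\<lambda>y. log 2 (pmf (?K x) y / pmf (bind_pmf P ?K) y)))"
    using fin P' by (subst expectation_bind_pmf_finite)
      (auto intro: finite_subset simp: dest_kernel_def block_kernel_def)
  also have "\<dots> = measure_pmf.expectation P (\<lambda>x. \<Sum>y\<in>?B. pmf (?K x) y *
      log 2 (pmf (?K x) y / pmf (bind_pmf P ?K) y))"
  proof (rule expectation_cong_on)
    fix x assume "x \<in> set_pmf P"
    thus "measure_pmf.expectation (?K x) (\<lambda>y. log 2 (pmf (?K x) y / pmf (bind_pmf P ?K) y)) =
      (\<Sum>y\<in>?B. pmf (?K x) y * log 2 (pmf (?K x) y / pmf (bind_pmf P ?K) y))"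
      using P' K fin by (subst integral_measure_pmf[of ?B]) auto
  qed
  also have "\<dots> = (\<Sum>x\<in>?A. pmf P x * (\<Sum>y\<in>?B. pmf (?K x) y *
      log 2 (pmf (?K x) y / pmf (bind_pmf P ?K) y)))"
    using P' fin by (subst integral_measure_pmf[of ?A]) auto
  also have "\<dots> = channel_information ?A ?B (pmf P) (\<lambda>x. pmf (?K x))"
    using fin by (subst channel_information_log_form) (auto simp: pmf_bind_sum[OF fin(3) P'] sum_distrib_left mult.assoc)
  finally show ?thesis by (simp add: info_eq_channel_information[OF N P a])
qed

text \<open>If the number of blocks is a multiple of \<open>k\<close>, the exponent n R is a natural
  number, so the message set can have exactly the size that \<open>achievable\<close>
  prescribes.\<close>

lemma achievable_rational:
  assumes N: "relay_channel N" and P: "P \<in> input_pmfs N" and a: "a \<in> relay_codes N"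
    and k: "k > 0" and less: "real j / real k < info_X1_Y3_given N (pair_pmf P (return_pmf a)) a"
  shows "achievable N (real j / real k / block_length N)"
  unfolding achievable_def
proof (intro allI impI)
  fix \<epsilon> :: real assume \<epsilon>: "\<epsilon> > 0"
  let ?L = "block_length N" and ?K = "dest_kernel N a" and ?r = "periodic_relay N a"
  let ?A = "seqs (alph_X1 N) (block_length N)"
  note fin = relay_channel_finite[OF N]
  have P': "set_pmf P \<subseteq> ?A" using P by (simp add: input_pmfs_def)
  obtain m0 where m0: "\<And>m M. m \<ge> m0 \<Longrightarrow> real M \<le> 2 powr (m * (real j / real k)) \<Longrightarrow>
    \<exists>c B. (\<forall>w<M. c w \<in> set_pmf (replicate_pmf m P) \<and>
        measure_pmf.prob (product_kernel ?K (c w)) (B w) \<ge> 1 - \<epsilon>) \<and> disjoint_family_on B {..<M}"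
  proof (rule channel_coding)
    show "finite (set_pmf P)" using P' fin finite_subset by blast
    show "finite (set_pmf (?K x))" for x using fin by (simp add: dest_kernel_def block_kernel_def)
    show "real j / real k < measure_pmf.expectation (bind_pmf P (\<lambda>x. map_pmf (Pair x) (?K x)))
        (\<lambda>(x, y). log 2 (pmf (?K x) y / pmf (bind_pmf P ?K) y))"
      using less by (simp only: info_eq_expectation[OF N P a])
    show "\<epsilon> > 0" by fact
  qed (erule that)
  \<comment> \<open>A positive multiple of \<open>k\<close> that is at least
    \<open>m0\<close>.\<close>
  define m where "m = k * Suc m0"
  define M where "M = (2::nat) ^ (Suc m0 * j)"
  have "m0 \<le> k * m0" using k by simp
  hence m: "m \<ge> m0" "m > 0"
    unfolding m_def mult_Suc_right using k by (simp_all only: trans_le_add2 add_pos_nonneg zero_le)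
  have M: "real M = 2 powr (m * (real j / real k))"
  proof -
    have "real m * (real j / real k) = real (Suc m0 * j)"
      using k by (simp only: m_def of_nat_mult) simp
    thus ?thesis by (simp only: powr_realpow M_def) simp
  qed
  obtain c B where c: "\<And>w. w < M \<Longrightarrow> c w \<in> set_pmf (replicate_pmf m P)"
    and B: "\<And>w. w < M \<Longrightarrow> measure_pmf.prob (product_kernel ?K (c w)) (B w) \<ge> 1 - \<epsilon>"
    and disj: "disjoint_family_on B {..<M}"
    using m0[OF m(1) eq_refl[OF M]] by blast
  have c': "length (c w) = m \<and> set (c w) \<subseteq> ?A" if "w < M" for w
    using c[OF that] P' by (auto simp: set_replicate_pmf)
  \<comment> \<open>Decoding sets contain lists of blocks, but the decoder sees a concatenation. As
    all blocks have the same length, the list can be recovered, and disjointness of the sets then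
    makes the decoded message unique.\<close>
  define blocks where "blocks = {ys. length ys = m \<and> (\<forall>y\<in>set ys. length (y :: 'd list) = ?L)}"
  define dec where "dec y = (SOME w. w < M \<and> (\<exists>ys\<in>blocks. y = concat ys \<and> ys \<in> B w))" for y
  have dec: "dec (concat ys) = w" if "w < M" "ys \<in> blocks" "ys \<in> B w" for ys w
    unfolding dec_def
  proof (rule some_equality)
    fix w' assume w': "w' < M \<and> (\<exists>ys'\<in>blocks. concat ys = concat ys' \<and> ys' \<in> B w')"
    then obtain ys' where ys': "ys' \<in> blocks" "concat ys = concat ys'" "ys' \<in> B w'" by blast
    have "ys' = ys"
      using that(2) ys'(1) by (intro concat_injective[OF ys'(2)[symmetric]])
        (fastforce simp: blocks_def dest: set_zip_leftD set_zip_rightD)+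
    thus "w' = w" using disj that w' ys'(3) by (auto simp: disjoint_family_on_def)
  qed (use that in blast)
  have err: "measure_pmf.prob (replicate_pmf m (noise N)) {zs. dec (dest_out N ?r (concat (c w)) m zs) \<noteq> w} \<le> \<epsilon>"
    if w: "w < M" for w
  proof -
    have "measure_pmf.prob (replicate_pmf m (noise N)) {zs. dec (dest_out N ?r (concat (c w)) m zs) \<noteq> w} =
        measure_pmf.prob (map_pmf (dest_out N ?r (concat (c w)) m) (replicate_pmf m (noise N))) {y. dec y \<noteq> w}"
      by (simp add: vimage_def)
    also have "map_pmf (dest_out N ?r (concat (c w)) m) (replicate_pmf m (noise N)) =
        map_pmf concat (product_kernel ?K (c w))"
      using dest_out_periodic_relay[OF fin(1), of "c w" a] c'[OF w] by (auto simp: seqs_def)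
    also have "measure_pmf.prob \<dots> {y. dec y \<noteq> w} =
        measure_pmf.prob (product_kernel ?K (c w)) {ys. dec (concat ys) \<noteq> w}"
      by (simp add: vimage_def)
    also have "\<dots> \<le> measure_pmf.prob (product_kernel ?K (c w)) (- B w)"
    proof (rule measure_pmf.finite_measure_mono_AE)
      have "ys \<in> blocks" if "ys \<in> set_pmf (product_kernel ?K (c w))" for ys
      proof -
        have len: "length y = ?L" if "y \<in> set_pmf (?K x)" for x y
          using that length_block_out[of N a x, OF prod.collapse[symmetric]]
          by (auto simp: dest_kernel_def block_kernel_def)
        have "list_all2 (\<lambda>_ y. length y = ?L) (c w) ys"
          by (rule list_all2_mono[OF set_product_kernel[OF that] len])
        thus ?thesis
          using c'[OF w] by (auto simp: blocks_def list_all2_conv_all_nth in_set_conv_nth)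
      qed
      thus "AE ys in product_kernel ?K (c w). ys \<in> {ys. dec (concat ys) \<noteq> w} \<longrightarrow> ys \<in> - B w"
        using dec[OF w] by (auto simp: AE_measure_pmf_iff)
    qed simp
    also have "\<dots> = 1 - measure_pmf.prob (product_kernel ?K (c w)) (B w)"
      using measure_pmf.prob_compl[of "B w" "product_kernel ?K (c w)"] by (simp add: Compl_eq_Diff_UNIV)
    also have "\<dots> \<le> \<epsilon>" using B[OF w] by simp
    finally show ?thesis .
  qed
  have "M > 0" by (simp add: M_def)
  have "error_prob N m M (\<lambda>w. concat (c w)) ?r dec \<le> (\<Sum>w<M. \<epsilon>) / M"
    unfolding error_prob_eq[OF \<open>M > 0\<close>] using err by (intro divide_right_mono sum_mono) auto
  hence "error_prob N m M (\<lambda>w. concat (c w)) ?r dec \<le> \<epsilon>" using \<open>M > 0\<close> by simp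
  moreover have "real M = 2 powr (real (m * ?L) * (real j / real k / ?L))"
    using M fin(1) by simp
  moreover have "valid_code N m M (\<lambda>w. concat (c w)) ?r"
    using c' by (intro valid_block_code[OF N a])
  ultimately show "\<exists>m>0. \<exists>M enc rel dec. real M = 2 powr (real (m * ?L) * (real j / real k / ?L)) \<and>
      valid_code N m M enc rel \<and> error_prob N m M enc rel dec \<le> \<epsilon>"
    using m(2) by blast
qed

theorem mainTheorem11:
  fixes N :: "('x1, 'x2, 'y2, 'y3, 'z) relay_ibm"
  assumes "relay_channel N" and "reversely_degraded N"
  shows "\<exists>inner outer.
    (\<forall>a\<in>relay_codes N.
       is_maximum ((\<lambda>P. info_X1_Y3_given N (pair_pmf P (return_pmf a)) a) ` input_pmfs N) (inner a)) \<and>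
    is_maximum (inner ` relay_codes N) outer \<and>
    capacity N = 1 / real (block_length N) * outer"
proof -
  let ?A = "seqs (alph_X1 N) (block_length N)" and ?B = "seqs (alph_Y3 N) (block_length N)"
  let ?I = "\<lambda>a P. info_X1_Y3_given N (pair_pmf P (return_pmf a)) a"
  note N = assms(1)
  note fin = relay_channel_finite[OF N]
  have "\<exists>i. is_maximum (?I a ` input_pmfs N) i" if a: "a \<in> relay_codes N" for a
  proof -
    obtain P where P: "set_pmf P \<subseteq> ?A" "\<And>Q. set_pmf Q \<subseteq> ?A \<Longrightarrow>
        channel_information ?A ?B (pmf Q) (\<lambda>x. pmf (dest_kernel N a x)) \<le> channel_information ?A ?B (pmf P) (\<lambda>x. pmf (dest_kernel N a x))"
      using channel_information_attains_max[OF fin(3,6,4), of "\<lambda>x. pmf (dest_kernel N a x)"] by auto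
    thus ?thesis
      using info_eq_channel_information[OF N _ a]
      by (intro exI[of _ "?I a P"]) (auto simp: is_maximum_def input_pmfs_def)
  qed
  then obtain inner where inner: "\<And>a. a \<in> relay_codes N \<Longrightarrow> is_maximum (?I a ` input_pmfs N) (inner a)"
    by metis
  define outer where "outer = Max (inner ` relay_codes N)"
  have outer: "is_maximum (inner ` relay_codes N) outer"
    using fin(7,8) by (auto simp: is_maximum_def outer_def)
  have le: "?I a P \<le> outer" if "a \<in> relay_codes N" "P \<in> input_pmfs N" for a P
    using inner[OF that(1)] outer that by (force simp: is_maximum_def)
  obtain a where a: "a \<in> relay_codes N" "outer = inner a"
    using outer by (auto simp: is_maximum_def)
  then obtain P where P: "P \<in> input_pmfs N" "outer = ?I a P"
    using inner[OF a(1)] by (auto simp: is_maximum_def)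
  have "Sup {R. achievable N R} = outer / block_length N"
  proof (rule cSup_eq_non_empty)
    show "{R. achievable N R} \<noteq> {}" using achievable_0[OF N] by auto
    show "R \<le> outer / block_length N" if "R \<in> {R. achievable N R}" for R
      using that achievable_le[OF N assms(2) le] by simp
    fix y assume y: "\<And>R. R \<in> {R. achievable N R} \<Longrightarrow> R \<le> y"
    show "outer / block_length N \<le> y"
    proof (rule ccontr)
      assume "\<not> ?thesis"
      hence "y * block_length N < outer" using fin(1) by (simp add: field_simps)
      \<comment> \<open>Here \<open>r\<close> is the number of bits per block; density of the
        rationals is all that is needed to refute a smaller upper bound.\<close>
      then obtain r where r: "r \<in> \<rat>" "y * block_length N < r" "r < outer"
        using Rats_dense_in_real by blast
      \<comment> \<open>Achievability of rate 0 makes \<open>r\<close> positive, hence a quotient of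
        natural numbers as \<open>achievable_rational\<close> requires.\<close>
      have "y \<ge> 0" using y achievable_0[OF N] by simp
      hence "r > 0" using r(2) by (meson le_less_trans mult_nonneg_nonneg of_nat_0_le_iff)
      then obtain j k :: nat where jk: "k \<noteq> 0" "r = real j / real k"
        using Rats_abs_nat_div_natE[OF r(1)] by (metis abs_of_pos)
      hence "achievable N (r / block_length N)"
        using achievable_rational[OF N P(1) a(1), of k j] r(3) P(2) by simp
      hence "r / block_length N \<le> y" using y by simp
      thus False using r(2) fin(1) by (simp add: field_simps)
    qed
  qed
  hence "capacity N = 1 / real (block_length N) * outer"
    by (simp add: capacity_def)
  with inner outer show ?thesis by blast
qed

end
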